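(* Let $\varphi\in L^2(0,1)$, regarded as a $2$-periodic odd function on $\mathbb{R}$, and for $n\in\mathbb{N}$ let $\varphi_n(x)=\varphi(nx)$, $x\in(0,1)$. Then the following assertions hold: (1) The system $\{\varphi_n\}_{n\ge 1}$ is a Bessel sequence in $L^2(0,1)$ if and only if $S\varphi\in\mathcal{M}$. (2) The system $\{\varphi_n\}_{n\ge 1}$ satisfies the lower frame bound in $L^2(0,1)$ if and only if $1/S\varphi\in\mathcal{M}$.
   Context: All spaces are over $\mathbb{C}$, and $\mathbb{N}=\{1,2,\dots\}$. Let $e_n(x)=\sqrt2\,\sin(\pi n x)$; $\{e_n\}_{n\ge1}$ is an orthonormal basis of $L^2(0,1)$. $\mathfrak{D}$ is the algebra of all formal Dirichlet series $\sum_{n\ge1}a_n n^{-s}$ ($a_n\in\mathbb{C}$) with Dirichlet multiplication $(\sum a_n n^{-s})*(\sum c_n n^{-s})=\sum_n\big(\sum_{dm=n}c_d a_m\big)n^{-s}$; an element is invertible in $\mathfrak{D}$ iff $a_1\ne0$. $\mathcal{H}^2$ is the Hilbert space of Dirichlet series with $\|\sum a_n n^{-s}\|_{\mathcal{H}^2}=(\sum_n|a_n|^2)^{1/2}<\infty$. $S:L^2(0,1)\to\mathcal{H}^2$ is the isometric isomorphism $S(\sum_n c_n e_n)=\sum_n c_n n^{-s}$. $\mathcal{M}$ is the set of multipliers of $\mathcal{H}^2$: those $D\in\mathfrak{D}$ such that $D*E\in\mathcal{H}^2$ for every $E\in\mathcal{H}^2$ (equivalently, $M_D:E\mapsto D*E$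 is a bounded operator on $\mathcal{H}^2$). The expression "$1/S\varphi\in\mathcal{M}$" means that $S\varphi$ is invertible in $\mathfrak{D}$ and its inverse belongs to $\mathcal{M}$. A sequence $\{\varphi_n\}$ in a Hilbert space $H$ is a Bessel sequence if there is $B>0$ with $\sum_n|\langle f,\varphi_n\rangle|^2\le B\|f\|^2$ for all $f\in H$; it satisfies the lower frame bound if there is $A>0$ with $A\|f\|^2\le\sum_n|\langle f,\varphi_n\rangle|^2$ for all $f\in H$ (the sum may be $+\infty$). *)

theory Defs
  imports "HOL-Analysis.Analysis"
begin

section \<open>The space \<open>L\<^sup>2(0,1)\<close>\<close>

text \<open>
  Elements of \<open>L\<^sup>2(0,1)\<close> are handled through representatives: functions on the real line of
  which only the restriction to the open unit interval matters.  Every notion below that takes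
  such a function is invariant under changes on a Lebesgue null set.
\<close>

definition L2_01 :: "(real \<Rightarrow> complex) set" where
  "L2_01 = {f. f \<in> borel_measurable (lebesgue_on {0<..<1}) \<and>
               integrable (lebesgue_on {0<..<1}) (\<lambda>x. (cmod (f x))\<^sup>2)}"

definition L2_inner :: "(real \<Rightarrow> complex) \<Rightarrow> (real \<Rightarrow> complex) \<Rightarrow> complex" where
  "L2_inner f g = (LINT x|lebesgue_on {0<..<1}. f x * cnj (g x))"

definition L2_norm :: "(real \<Rightarrow> complex) \<Rightarrow> real" where
  "L2_norm f = sqrt (LINT x|lebesgue_on {0<..<1}. (cmod (f x))\<^sup>2)"

definition sine_basis :: "nat \<Rightarrow> real \<Rightarrow> complex" where
  "sine_basis n x = complex_of_real (sqrt 2 * sin (pi * real n * x))"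

text \<open>
  Systems are indexed by the positive integers, so the value at index \<open>0\<close> is ignored: the series
  runs over \<open>Suc n\<close>.  It is taken in the extended nonnegative reals because it may diverge.
\<close>

definition sum_sq_coeffs :: "(real \<Rightarrow> complex) \<Rightarrow> (nat \<Rightarrow> real \<Rightarrow> complex) \<Rightarrow> ennreal" where
  "sum_sq_coeffs f \<psi> = (\<Sum>n. ennreal ((cmod (L2_inner f (\<psi> (Suc n))))\<^sup>2))"

definition bessel_sequence :: "(nat \<Rightarrow> real \<Rightarrow> complex) \<Rightarrow> bool" where
  "bessel_sequence \<psi> \<longleftrightarrow>
     (\<exists>B>0. \<forall>f\<in>L2_01. sum_sq_coeffs f \<psi> \<le> ennreal (B * (L2_norm f)\<^sup>2))"

definition lower_frame_bound :: "(nat \<Rightarrow> real \<Rightarrow> complex) \<Rightarrow> bool" where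
  "lower_frame_bound \<psi> \<longleftrightarrow>
     (\<exists>A>0. \<forall>f\<in>L2_01. ennreal (A * (L2_norm f)\<^sup>2) \<le> sum_sq_coeffs f \<psi>)"

section \<open>Odd 2-periodic extension and dilations\<close>

text \<open>Here \<open>y\<close> is the representative of \<open>x\<close> modulo 2 in \<open>[-1,1)\<close>.\<close>

definition odd_periodic_ext :: "(real \<Rightarrow> complex) \<Rightarrow> real \<Rightarrow> complex" where
  "odd_periodic_ext \<phi> x =
     (let y = x - 2 * of_int \<lfloor>(x + 1) / 2\<rfloor>
      in if 0 < y then \<phi> y else if -1 < y \<and> y < 0 then - \<phi> (- y) else 0)"

definition dilation_system :: "(real \<Rightarrow> complex) \<Rightarrow> nat \<Rightarrow> real \<Rightarrow> complex" where
  "dilation_system \<phi> n x = odd_periodic_ext \<phi> (real n * x)"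

lemma odd_periodic_ext_reduce:
  assumes "-1 \<le> x - 2 * of_int k" "x - 2 * of_int k < 1"
  shows "odd_periodic_ext \<phi> x =
     (let y = x - 2 * of_int k
      in if 0 < y then \<phi> y else if -1 < y \<and> y < 0 then - \<phi> (- y) else 0)"
proof -
  have "\<lfloor>(x + 1) / 2\<rfloor> = k" using assms by (simp add: floor_eq_iff field_simps)
  then show ?thesis unfolding odd_periodic_ext_def by (simp only:)
qed

lemma mod_two_representative:
  obtains k where "-1 \<le> x - 2 * of_int k" "x - 2 * of_int k < (1::real)"
proof -
  have "of_int \<lfloor>(x + 1) / 2\<rfloor> \<le> (x + 1) / 2" "(x + 1) / 2 < of_int \<lfloor>(x + 1) / 2\<rfloor> + 1"
    by linarith+
  then have "-1 \<le> x - 2 * of_int \<lfloor>(x + 1) / 2\<rfloor>" "x - 2 * of_int \<lfloor>(x + 1) / 2\<rfloor> < 1"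
    by (simp_all add: field_simps)
  then show ?thesis by (rule that)
qed

lemma odd_periodic_ext_eq:
  assumes "0 < x" "x < 1"
  shows "odd_periodic_ext \<phi> x = \<phi> x"
  using odd_periodic_ext_reduce [of x 0 \<phi>] assms by simp

lemma odd_periodic_ext_periodic: "odd_periodic_ext \<phi> (x + 2) = odd_periodic_ext \<phi> x"
proof -
  obtain k where k: "-1 \<le> x - 2 * of_int k" "x - 2 * of_int k < (1::real)"
    by (rule mod_two_representative)
  have eq: "x + 2 - 2 * of_int (k + 1) = x - 2 * of_int k" by simp
  show ?thesis
    using odd_periodic_ext_reduce [of x k \<phi>] odd_periodic_ext_reduce [of "x + 2" "k + 1" \<phi>] k
    unfolding eq by simp
qed

lemma odd_periodic_ext_odd: "odd_periodic_ext \<phi> (- x) = - odd_periodic_ext \<phi> x"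
proof -
  obtain k where k: "-1 \<le> x - 2 * of_int k" "x - 2 * of_int k < (1::real)"
    by (rule mod_two_representative)
  define y where "y = x - 2 * of_int k"
  have y: "-1 \<le> y" "y < 1" using k by (simp_all add: y_def)
  have x: "odd_periodic_ext \<phi> x =
      (if 0 < y then \<phi> y else if -1 < y \<and> y < 0 then - \<phi> (- y) else 0)"
    using odd_periodic_ext_reduce [of x k \<phi>] k by (simp add: y_def Let_def)
  show ?thesis
  proof (cases "y = -1")
    case True
    have eq: "- x - 2 * of_int (1 - k) = -1" using True by (simp add: y_def)
    have "odd_periodic_ext \<phi> (- x) = 0"
      using odd_periodic_ext_reduce [of "- x" "1 - k" \<phi>] unfolding eq by simp
    then show ?thesis using x True by simp
  next
    case False
    have eq: "- x - 2 * of_int (- k) = - y" by (simp add: y_def)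
    have "odd_periodic_ext \<phi> (- x) =
        (if 0 < - y then \<phi> (- y) else if -1 < - y \<and> - y < 0 then - \<phi> y else 0)"
      using odd_periodic_ext_reduce [of "- x" "- k" \<phi>] y False unfolding eq by (simp add: Let_def)
    then show ?thesis using x y False by simp
  qed
qed

lemma odd_periodic_ext_unique:
  assumes eq: "\<And>x. 0 < x \<Longrightarrow> x < 1 \<Longrightarrow> g x = \<phi> x"
    and per: "\<And>x. g (x + 2) = g x" and odd: "\<And>x. g (- x) = - g x"
  shows "g = odd_periodic_ext \<phi>"
proof
  fix x :: real
  have up: "g (x + 2 * of_nat n) = g x" for n x
  proof (induction n)
    case (Suc n)
    have "x + 2 * of_nat (Suc n) = (x + 2 * of_nat n) + 2" by simp
    then show ?case using per Suc by metis
  qed simp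
  have shift: "g (x - 2 * of_int k) = g x" for k
    using up [of x "nat (- k)"] up [of "x - 2 * of_int k" "nat k"] by (cases "k \<ge> 0") auto
  have zero: "z = 0" if "z = - z" for z :: complex
    using that by (simp add: complex_eq_iff)
  have g0: "g 0 = 0" using odd [of 0] zero by simp
  have g1: "g (-1) = 0" using odd [of 1] per [of "-1"] zero [of "g 1"] by simp
  obtain k where k: "-1 \<le> x - 2 * of_int k" "x - 2 * of_int k < (1::real)"
    by (rule mod_two_representative)
  define y where "y = x - 2 * of_int k"
  have y: "-1 \<le> y" "y < 1" using k by (simp_all add: y_def)
  have "g x = g y" unfolding y_def by (simp add: shift)
  also have "\<dots> = (if 0 < y then \<phi> y else if -1 < y \<and> y < 0 then - \<phi> (- y) else 0)"
    using y g0 g1 eq [of y] eq [of "- y"] odd [of "- y"]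
    by (cases "y = 0"; cases "y = -1") auto
  also have "\<dots> = odd_periodic_ext \<phi> x"
    using odd_periodic_ext_reduce [of x k \<phi>] k by (simp add: y_def Let_def)
  finally show "g x = odd_periodic_ext \<phi> x" .
qed

section \<open>Formal Dirichlet series, \<open>H\<^sup>2\<close> and its multipliers\<close>

text \<open>
  A formal Dirichlet series is its coefficient sequence; the unused coefficient at index \<open>0\<close> is
  required to vanish so that equality of series is equality of functions.
\<close>

definition dirichlet_series :: "(nat \<Rightarrow> complex) set" where
  "dirichlet_series = {a. a 0 = 0}"

definition dirichlet_mult :: "(nat \<Rightarrow> complex) \<Rightarrow> (nat \<Rightarrow> complex) \<Rightarrow> nat \<Rightarrow> complex"
    (infixl "\<star>" 70) where
  "(a \<star> c) n = (if n = 0 then 0 else \<Sum>d | d dvd n. c d * a (n div d))"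

definition dirichlet_one :: "nat \<Rightarrow> complex" where
  "dirichlet_one n = (if n = 1 then 1 else 0)"

definition is_dirichlet_inverse :: "(nat \<Rightarrow> complex) \<Rightarrow> (nat \<Rightarrow> complex) \<Rightarrow> bool" where
  "is_dirichlet_inverse D E \<longleftrightarrow> E \<in> dirichlet_series \<and> D \<star> E = dirichlet_one \<and> E \<star> D = dirichlet_one"

definition hardy_dirichlet :: "(nat \<Rightarrow> complex) set" where
  "hardy_dirichlet = {a \<in> dirichlet_series. summable (\<lambda>n. (cmod (a n))\<^sup>2)}"

definition multipliers :: "(nat \<Rightarrow> complex) set" where
  "multipliers = {D \<in> dirichlet_series. \<forall>E\<in>hardy_dirichlet. D \<star> E \<in> hardy_dirichlet}"

text \<open>
  The isomorphism from \<open>L\<^sup>2(0,1)\<close> onto \<open>H\<^sup>2\<close> sends the expansion of \<open>f\<close> in the orthonormal basis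
  \<open>sine_basis\<close> to the Dirichlet series with the same coefficients; the \<open>n\<close>-th coefficient of
  that expansion is the inner product of \<open>f\<close> with the \<open>n\<close>-th basis vector.
\<close>

definition S_transform :: "(real \<Rightarrow> complex) \<Rightarrow> nat \<Rightarrow> complex" where
  "S_transform f n = (if n = 0 then 0 else L2_inner f (sine_basis n))"

text \<open>\<open>1/D \<in> \<M>\<close>: the series \<open>D\<close> is invertible and its (unique) inverse is a multiplier.\<close>

definition reciprocal_is_multiplier :: "(nat \<Rightarrow> complex) \<Rightarrow> bool" where
  "reciprocal_is_multiplier D \<longleftrightarrow> (\<exists>E. is_dirichlet_inverse D E \<and> E \<in> multipliers)"

end

theory Submission
  imports Defs "HOL-Computational_Algebra.Primes"
begin

text \<open>
  Write \<open>a = S\<phi>\<close>. Dilation by \<open>n\<close> is isometric and sends \<open>e\<^sub>k\<close> to \<open>e\<^sub>n\<^sub>k\<close>, so the coefficient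
  \<open>\<langle>f, \<phi>\<^sub>n\<rangle>\<close> is the \<open>n\<close>-th entry of the adjoint of \<open>E \<mapsto> a \<star> E\<close> applied to \<open>Sf\<close>. Part (1) says that
  a multiplication operator is bounded iff its adjoint is. For part (2), a lower bound on finite
  sequences, where the adjoint is invertible, is a norm bound for multiplication by \<open>b = 1/a\<close>.

  The converse is delicate because multiplication by \<open>a\<close> may be unbounded. Put
  \<open>b\<^sub>L = w\<^sub>L b\<close> with Fejer weights \<open>w\<^sub>L(n) = max(0, 1 - h(n)/L)\<close>, \<open>h\<close> being the sum of the prime factors
  with multiplicity. As \<open>h\<close> is completely additive with finite level sets, \<open>b\<^sub>L\<close> has finite support and acts with
  norm at most that of \<open>b\<close>. Since \<open>a \<star> b\<^sub>L \<star> E = b\<^sub>L \<star> (a \<star> E)\<close> is bounded in \<open>H\<^sup>2\<close> and converges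
  coefficientwise to \<open>E\<close>, it converges weakly, so \<open>\<langle>Sf, E\<rangle>\<close> is the limit of the pairings of the
  coefficients \<open>\<langle>f, \<phi>\<^sub>n\<rangle>\<close> with \<open>b\<^sub>L \<star> E\<close>.
\<close>

section \<open>Dirichlet multiplication and its adjoint\<close>

lemma dirichlet_mult_comm: "a \<star> b = b \<star> a"
proof
  fix n
  show "(a \<star> b) n = (b \<star> a) n"
  proof (cases "n = 0")
    case False
    have "(\<Sum>d | d dvd n. b d * a (n div d)) = (\<Sum>d | d dvd n. a d * b (n div d))"
      by (rule sum.reindex_bij_witness [of _ "\<lambda>d. n div d" "\<lambda>d. n div d"])
        (use False in \<open>auto simp: mult.commute elim!: dvdE\<close>)
    then show ?thesis by (simp add: dirichlet_mult_def)
  qed (simp add: dirichlet_mult_def)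
qed

text \<open>Both sides sum over ordered factorisations of \<open>n\<close> into three factors. The
  reindexing replaces a divisor \<open>d\<close> and a divisor \<open>e\<close> of
  \<open>n div d\<close> by \<open>f = d * e\<close> together with its divisor
  \<open>d\<close>.\<close>

lemma dirichlet_mult_assoc: "(a \<star> b) \<star> c = a \<star> (b \<star> c)"
proof
  fix n
  show "((a \<star> b) \<star> c) n = (a \<star> (b \<star> c)) n"
  proof (cases "n = 0")
    case False
    then have fin: "finite {d. d dvd n}" by simp
    have "((a \<star> b) \<star> c) n =
        (\<Sum>d | d dvd n. \<Sum>e | e dvd n div d. c d * (b e * a (n div d div e)))"
      using False by (auto simp: dirichlet_mult_def sum_distrib_left intro!: sum.cong elim!: dvdE)
    also have "\<dots> = (\<Sum>(d, e)\<in>(SIGMA d:{d. d dvd n}. {e. e dvd n div d}).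
        c d * (b e * a (n div d div e)))"
      by (subst sum.Sigma) (use False in \<open>auto elim!: dvdE\<close>)
    also have "\<dots> = (\<Sum>(f, d)\<in>(SIGMA f:{f. f dvd n}. {d. d dvd f}).
        c d * b (f div d) * a (n div f))"
      by (rule sum.reindex_bij_witness [of _ "\<lambda>(f, d). (d, f div d)" "\<lambda>(d, e). (d * e, d)"])
        (use False in \<open>auto simp: div_mult2_eq elim!: dvdE\<close>)
    also have "\<dots> = (\<Sum>f | f dvd n. \<Sum>d | d dvd f. c d * b (f div d) * a (n div f))"
      by (subst sum.Sigma) (use False fin in \<open>auto elim!: dvdE\<close>)
    also have "\<dots> = (a \<star> (b \<star> c)) n"
      using False by (auto simp: dirichlet_mult_def sum_distrib_right intro!: sum.cong elim!: dvdE)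
    finally show ?thesis .
  qed (simp add: dirichlet_mult_def)
qed

lemma dirichlet_mult_add_right: "a \<star> (\<lambda>n. b n + c n) = (\<lambda>n. (a \<star> b) n + (a \<star> c) n)"
  by (rule ext) (simp add: dirichlet_mult_def sum.distrib algebra_simps)

lemma dirichlet_mult_scale_right: "a \<star> (\<lambda>n. t * b n) = (\<lambda>n. t * (a \<star> b) n)"
  by (rule ext) (simp add: dirichlet_mult_def sum_distrib_left algebra_simps)

lemma dirichlet_mult_0 [simp]: "(a \<star> b) 0 = 0"
  by (simp add: dirichlet_mult_def)

section \<open>Monomials and the inverse series\<close>

definition dirichlet_delta :: "nat \<Rightarrow> nat \<Rightarrow> complex" where
  "dirichlet_delta m n = (if n = m then 1 else 0)"

lemma dirichlet_one_eq_delta: "dirichlet_one = dirichlet_delta 1"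
  by (auto simp: dirichlet_one_def dirichlet_delta_def)

lemma dirichlet_mult_delta_right:
  assumes "m > 0"
  shows "(a \<star> dirichlet_delta m) n = (if n > 0 \<and> m dvd n then a (n div m) else 0)"
proof (cases "n = 0")
  case False
  have "(\<Sum>d | d dvd n. dirichlet_delta m d * a (n div d)) =
      (\<Sum>d | d dvd n. if d = m then a (n div d) else 0)"
    by (rule sum.cong) (auto simp: dirichlet_delta_def)
  also have "\<dots> = (if m dvd n then a (n div m) else 0)"
    using False by (subst sum.delta) auto
  finally show ?thesis using False by (simp add: dirichlet_mult_def)
qed simp

lemma dirichlet_mult_one_right: "n > 0 \<Longrightarrow> (a \<star> dirichlet_one) n = a n"
  by (simp add: dirichlet_one_eq_delta dirichlet_mult_delta_right)

text \<open>Solves \<open>a \<star> E = dirichlet_one\<close> coefficient by coefficient: for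
  \<open>n > 1\<close> the divisor \<open>n\<close> contributes \<open>E n * a 1\<close>, and all
  other terms involve earlier coefficients of \<open>E\<close>.\<close>

fun dirichlet_inv :: "(nat \<Rightarrow> complex) \<Rightarrow> nat \<Rightarrow> complex" where
  "dirichlet_inv a n = (if n = 0 then 0 else if n = 1 then 1 / a 1
     else - (\<Sum>d\<in>{d. d dvd n \<and> d < n}. dirichlet_inv a d * a (n div d)) / a 1)"

declare dirichlet_inv.simps [simp del]

lemma is_dirichlet_inverse_dirichlet_inv:
  assumes "a 1 \<noteq> 0"
  shows "is_dirichlet_inverse a (dirichlet_inv a)"
proof -
  have "(a \<star> dirichlet_inv a) n = dirichlet_one n" for n
  proof -
    consider "n = 0" | "n = 1" | "n > 1" by linarith
    then show ?thesis
    proof cases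
      case 3
      have "{d. d dvd n} = insert n {d. d dvd n \<and> d < n}"
        using 3 by (auto dest: dvd_imp_le)
      then have "(a \<star> dirichlet_inv a) n = dirichlet_inv a n * a (n div n) +
          (\<Sum>d\<in>{d. d dvd n \<and> d < n}. dirichlet_inv a d * a (n div d))"
        using 3 by (simp add: dirichlet_mult_def)
      also have "\<dots> = 0"
        using 3 assms by (subst dirichlet_inv.simps) simp
      finally show ?thesis using 3 by (simp add: dirichlet_one_def)
    qed (use assms in \<open>simp_all add: dirichlet_mult_def dirichlet_one_def dirichlet_inv.simps\<close>)
  qed
  then have "a \<star> dirichlet_inv a = dirichlet_one" by blast
  then show ?thesis
    using dirichlet_mult_comm [of a "dirichlet_inv a"]
    by (simp add: is_dirichlet_inverse_def dirichlet_series_def dirichlet_inv.simps)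
qed

section \<open>Partial sums of squares and truncation\<close>

definition sqsum :: "nat \<Rightarrow> (nat \<Rightarrow> complex) \<Rightarrow> real" where
  "sqsum N c = (\<Sum>n=1..N. (cmod (c n))\<^sup>2)"

definition trunc :: "nat \<Rightarrow> (nat \<Rightarrow> complex) \<Rightarrow> nat \<Rightarrow> complex" where
  "trunc N c n = (if n \<in> {1..N} then c n else 0)"

lemma sqsum_nonneg [simp]: "0 \<le> sqsum N c"
  by (simp add: sqsum_def sum_nonneg)

lemma sqsum_mono: "M \<le> N \<Longrightarrow> sqsum M c \<le> sqsum N c"
  unfolding sqsum_def by (rule sum_mono2) auto

lemma sqsum_cong: "(\<And>n. n \<in> {1..N} \<Longrightarrow> c n = d n) \<Longrightarrow> sqsum N c = sqsum N d"
  unfolding sqsum_def by (rule sum.cong) auto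

lemma sqsum_trunc: "sqsum M (trunc N c) = sqsum (min M N) c"
proof -
  have "sqsum M (trunc N c) = (\<Sum>n=1..M. if n \<in> {1..N} then (cmod (c n))\<^sup>2 else 0)"
    unfolding sqsum_def by (rule sum.cong) (auto simp: trunc_def)
  also have "\<dots> = (\<Sum>n\<in>{1..M} \<inter> {1..N}. (cmod (c n))\<^sup>2)"
    by (rule sum.inter_restrict [symmetric]) simp
  finally show ?thesis by (simp add: sqsum_def)
qed

lemma sqsum_eq_of_support:
  assumes "\<And>n. n > M \<Longrightarrow> c n = 0" "M \<le> N"
  shows "sqsum N c = sqsum M c"
  unfolding sqsum_def by (rule sum.mono_neutral_right) (use assms in auto)

text \<open>Divisors of \<open>n > 0\<close> are at most \<open>n\<close>, so multiplication is
  triangular. This is what allows norm bounds to be stated on initial segments.\<close>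

lemma dirichlet_mult_cong:
  assumes "\<And>d. d \<in> {1..n} \<Longrightarrow> c d = e d"
  shows "(a \<star> c) n = (a \<star> e) n"
proof (cases "n = 0")
  case False
  have "c d = e d" if "d dvd n" for d
    using dvd_imp_le [OF that] that False by (cases "d = 0") (auto intro: assms)
  then show ?thesis using False by (simp add: dirichlet_mult_def)
qed simp

lemma dirichlet_mult_trunc: "n \<le> N \<Longrightarrow> (a \<star> trunc N c) n = (a \<star> c) n"
  by (rule dirichlet_mult_cong) (simp add: trunc_def)

lemma sqsum_dirichlet_mult_trunc: "sqsum N (a \<star> trunc N c) = sqsum N (a \<star> c)"
  by (rule sqsum_cong) (simp add: dirichlet_mult_trunc)

lemma hardy_dirichlet_iff_sqsum:
  "c \<in> hardy_dirichlet \<longleftrightarrow> c 0 = 0 \<and> (\<exists>R. \<forall>N. sqsum N c \<le> R)"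
proof (cases "c 0 = 0")
  case True
  have eq: "(\<Sum>n<Suc N. (cmod (c n))\<^sup>2) = sqsum N c" for N
    unfolding sqsum_def lessThan_Suc_atMost
    by (rule sum.mono_neutral_right) (use True in \<open>auto simp: not_less_eq_eq\<close>)
  have "\<exists>R. \<forall>N. sqsum N c \<le> R" if "summable (\<lambda>n. (cmod (c n))\<^sup>2)"
    using sum_le_suminf [OF that] eq by (metis finite_lessThan zero_le_power2)
  moreover have "summable (\<lambda>n. (cmod (c n))\<^sup>2)" if "\<forall>N. sqsum N c \<le> R" for R
  proof (rule bounded_imp_summable)
    show "(\<Sum>k\<le>n. (cmod (c k))\<^sup>2) \<le> R" for n
      using that eq [of n] unfolding lessThan_Suc_atMost by simp
  qed simp
  ultimately show ?thesis using True by (auto simp: hardy_dirichlet_def dirichlet_series_def)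
qed (simp add: hardy_dirichlet_def dirichlet_series_def)

section \<open>Cauchy-Schwarz and the adjoint of multiplication\<close>

lemma norm_sum_mult_cnj_le:
  "(cmod (\<Sum>i\<in>A. u i * cnj (v i)))\<^sup>2 \<le> (\<Sum>i\<in>A. (cmod (u i))\<^sup>2) * (\<Sum>i\<in>A. (cmod (v i))\<^sup>2)"
proof -
  have "cmod (\<Sum>i\<in>A. u i * cnj (v i)) \<le> (\<Sum>i\<in>A. cmod (u i) * cmod (v i))"
    by (rule order_trans [OF norm_sum]) (simp add: norm_mult)
  then have "(cmod (\<Sum>i\<in>A. u i * cnj (v i)))\<^sup>2 \<le> (\<Sum>i\<in>A. cmod (u i) * cmod (v i))\<^sup>2"
    by (intro power_mono) auto
  also note Cauchy_Schwarz_ineq_sum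
  finally show ?thesis .
qed

text \<open>Cauchy-Schwarz for partial sums, passed to the limit. The hypothesis on
  \<open>u 0\<close> removes the one term that \<open>sqsum\<close> does not count.\<close>

lemma norm_sums_mult_cnj_le:
  assumes s: "(\<lambda>m. u m * cnj (v m)) sums s" and 0: "u 0 = 0"
    and U: "\<And>N. sqsum N u \<le> U" and V: "\<And>N. sqsum N v \<le> V"
  shows "(cmod s)\<^sup>2 \<le> U * V"
proof (rule LIMSEQ_le_const2)
  show "(\<lambda>n. (cmod (\<Sum>m\<le>n. u m * cnj (v m)))\<^sup>2) \<longlonglongrightarrow> (cmod s)\<^sup>2"
    using s unfolding sums_def_le by (intro tendsto_intros)
  have "(cmod (\<Sum>m\<le>n. u m * cnj (v m)))\<^sup>2 \<le> U * V" for n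
  proof -
    have "(\<Sum>m\<le>n. u m * cnj (v m)) = (\<Sum>m=1..n. u m * cnj (v m))"
      by (rule sum.mono_neutral_right) (use 0 in \<open>auto simp: not_less_eq_eq\<close>)
    then have "(cmod (\<Sum>m\<le>n. u m * cnj (v m)))\<^sup>2 \<le> sqsum n u * sqsum n v"
      unfolding sqsum_def by (simp only: norm_sum_mult_cnj_le)
    also have "\<dots> \<le> U * V"
      using U V by (intro mult_mono) (auto intro: order_trans [OF sqsum_nonneg])
    finally show ?thesis .
  qed
  then show "\<exists>N. \<forall>n\<ge>N. (cmod (\<Sum>m\<le>n. u m * cnj (v m)))\<^sup>2 \<le> U * V" by blast
qed

text \<open>The formal adjoint of multiplication by \<open>a\<close>: for \<open>n > 0\<close> it
  pairs \<open>f\<close> with \<open>a \<star> dirichlet_delta n\<close>. The series may diverge and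
  then has an unspecified value; \<open>adjoint_summable\<close> excludes this and also makes the
  term \<open>k = 0\<close> vanish.\<close>

definition dirichlet_adjoint :: "(nat \<Rightarrow> complex) \<Rightarrow> (nat \<Rightarrow> complex) \<Rightarrow> nat \<Rightarrow> complex" where
  "dirichlet_adjoint a f n = (\<Sum>k. f (n * k) * cnj (a k))"

definition adjoint_summable :: "(nat \<Rightarrow> complex) \<Rightarrow> (nat \<Rightarrow> complex) \<Rightarrow> bool" where
  "adjoint_summable a f \<longleftrightarrow> f 0 = 0 \<and> (\<forall>n>0. summable (\<lambda>k. f (n * k) * cnj (a k)))"

lemma adjoint_summable_hardy:
  assumes a: "a \<in> hardy_dirichlet" and f: "f \<in> hardy_dirichlet"
  shows "adjoint_summable a f"
  unfolding adjoint_summable_def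
proof (intro conjI allI impI)
  show "f 0 = 0" using f by (simp add: hardy_dirichlet_def dirichlet_series_def)
  fix n :: nat assume n: "n > 0"
  have "strict_mono (\<lambda>k. n * k)" using n by (simp add: strict_mono_def)
  moreover have "summable (\<lambda>n. (cmod (f n))\<^sup>2)"
    using f by (simp add: hardy_dirichlet_def)
  ultimately have "summable (\<lambda>k. (cmod (f (n * k)))\<^sup>2)"
    using summable_reindex [of "\<lambda>n. (cmod (f n))\<^sup>2" "\<lambda>k. n * k"]
    by (simp add: strict_mono_imp_inj_on o_def)
  moreover have "summable (\<lambda>k. (cmod (a k))\<^sup>2)"
    using a by (simp add: hardy_dirichlet_def)
  ultimately have sm: "summable (\<lambda>k. (cmod (f (n * k)))\<^sup>2 + (cmod (a k))\<^sup>2)"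
    by (rule summable_add)
  show "summable (\<lambda>k. f (n * k) * cnj (a k))"
  proof (rule summable_comparison_test' [OF sm, of 0])
    fix k
    have "2 * (cmod (f (n * k)) * cmod (a k)) \<le> (cmod (f (n * k)))\<^sup>2 + (cmod (a k))\<^sup>2"
      using sum_squares_bound [of "cmod (f (n * k))" "cmod (a k)"] by (simp add: mult.assoc)
    moreover have "0 \<le> cmod (f (n * k)) * cmod (a k)" by simp
    ultimately show "norm (f (n * k) * cnj (a k)) \<le> (cmod (f (n * k)))\<^sup>2 + (cmod (a k))\<^sup>2"
      unfolding norm_mult complex_mod_cnj by linarith
  qed
qed

lemma adjoint_summable_trunc: "adjoint_summable a (trunc N f)"
  unfolding adjoint_summable_def
proof (intro conjI allI impI)
  fix n :: nat assume "n > 0"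
  then have le: "1 * k \<le> n * k" for k by (intro mult_le_mono1) simp
  have "trunc N f (n * k) = 0" if "k > N" for k
  proof -
    have "N < n * k" using that le [of k] by linarith
    then show ?thesis by (simp add: trunc_def)
  qed
  from this show "summable (\<lambda>k. trunc N f (n * k) * cnj (a k))"
    by (intro summable_finite [of "{..N}"]) auto
qed (simp add: trunc_def)

lemma dirichlet_adjoint_trunc_eq_0: "n > N \<Longrightarrow> dirichlet_adjoint a (trunc N f) n = 0"
  unfolding dirichlet_adjoint_def
proof -
  assume "n > N"
  then have "trunc N f (n * k) = 0" for k
    by (cases k) (auto simp: trunc_def)
  then show "(\<Sum>k. trunc N f (n * k) * cnj (a k)) = 0" by simp
qed

text \<open>The adjoint identity for finitely supported \<open>E\<close>. Finitely many convergent
  series, one for each \<open>n\<close>, are added; at a fixed \<open>m\<close> only the divisors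
  \<open>n\<close> of \<open>m\<close> survive, and they reassemble the Dirichlet product.\<close>

lemma dirichlet_adjoint_sums:
  assumes "adjoint_summable a f"
  shows "(\<lambda>m. f m * cnj ((a \<star> trunc N E) m)) sums (\<Sum>n=1..N. dirichlet_adjoint a f n * cnj (E n))"
proof -
  have one: "(\<lambda>m. if n dvd m then f m * cnj (a (m div n)) else 0) sums dirichlet_adjoint a f n"
    if "n > 0" for n
  proof -
    have "(\<lambda>k. f (n * k) * cnj (a k)) sums dirichlet_adjoint a f n"
      using assms that by (simp add: adjoint_summable_def dirichlet_adjoint_def summable_sums)
    \<comment> \<open>The series in \<open>k\<close> is spread over the multiples of
      \<open>n\<close>, with zeros in between, so that all \<open>n\<close> share the summation
      index \<open>m\<close>.\<close>
    moreover have "((\<lambda>k. (\<lambda>m. if n dvd m then f m * cnj (a (m div n)) else 0) (n * k)) sums c) \<longleftrightarrow>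
        ((\<lambda>m. if n dvd m then f m * cnj (a (m div n)) else 0) sums c)" for c
      by (rule sums_mono_reindex) (use that in \<open>auto simp: strict_mono_def\<close>)
    ultimately show ?thesis using that by simp
  qed
  have "(\<lambda>m. \<Sum>n=1..N. (if n dvd m then f m * cnj (a (m div n)) else 0) * cnj (E n))
      sums (\<Sum>n=1..N. dirichlet_adjoint a f n * cnj (E n))"
    by (intro sums_sum sums_mult2 one) auto
  moreover have "(\<Sum>n=1..N. (if n dvd m then f m * cnj (a (m div n)) else 0) * cnj (E n)) =
      f m * cnj ((a \<star> trunc N E) m)" for m
  proof (cases "m = 0")
    case False
    have "(\<Sum>n=1..N. (if n dvd m then f m * cnj (a (m div n)) else 0) * cnj (E n)) =
        (\<Sum>n\<in>{1..N}. if n \<in> {d. d dvd m} then f m * cnj (E n * a (m div n)) else 0)"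
      by (rule sum.cong) auto
    also have "\<dots> = (\<Sum>n\<in>{1..N} \<inter> {d. d dvd m}. f m * cnj (E n * a (m div n)))"
      by (rule sum.inter_restrict [symmetric]) simp
    also have "\<dots> = (\<Sum>n\<in>{d. d dvd m}. f m * cnj (trunc N E n * a (m div n)))"
      by (rule sum.mono_neutral_cong_left) (use False in \<open>auto simp: trunc_def\<close>)
    also have "\<dots> = f m * cnj ((a \<star> trunc N E) m)"
      using False by (simp add: dirichlet_mult_def sum_distrib_left)
    finally show ?thesis .
  qed (use assms in \<open>simp add: adjoint_summable_def\<close>)
  ultimately show ?thesis by simp
qed

text \<open>A finite form of the adjoint identity for arbitrary \<open>f\<close> and
  \<open>E\<close>: by triangularity, cutting \<open>f\<close> at \<open>N\<close> also cuts
  \<open>E\<close> at \<open>N\<close>, and no convergence question remains.\<close>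

lemma dirichlet_adjoint_trunc_sum:
  "(\<Sum>m=1..N. f m * cnj ((a \<star> E) m)) = (\<Sum>n=1..N. dirichlet_adjoint a (trunc N f) n * cnj (E n))"
proof -
  have "(\<lambda>m. trunc N f m * cnj ((a \<star> trunc N E) m)) sums
      (\<Sum>m=1..N. trunc N f m * cnj ((a \<star> trunc N E) m))"
    by (rule sums_finite) (auto simp: trunc_def)
  moreover have "(\<Sum>m=1..N. trunc N f m * cnj ((a \<star> trunc N E) m)) = (\<Sum>m=1..N. f m * cnj ((a \<star> E) m))"
    by (rule sum.cong) (auto simp: dirichlet_mult_trunc trunc_def)
  ultimately show ?thesis
    using sums_unique2 dirichlet_adjoint_sums [OF adjoint_summable_trunc] by metis
qed

text \<open>Since the first \<open>N\<close> coefficients of \<open>D \<star> E\<close> only depend on those of \<open>E\<close>, this is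
  boundedness of multiplication by \<open>D\<close> on \<open>H\<^sup>2\<close>, with squared operator norm at most \<open>B\<close>.\<close>
definition mult_bounded :: "real \<Rightarrow> (nat \<Rightarrow> complex) \<Rightarrow> bool" where
  "mult_bounded B D \<longleftrightarrow> (\<forall>E N. sqsum N (D \<star> E) \<le> B * sqsum N E)"

lemma le_of_square_le_mult:
  fixes s :: real
  assumes "s\<^sup>2 \<le> s * c" "0 \<le> s" "0 \<le> c"
  shows "s \<le> c"
  using assms by (cases "s = 0") (simp_all add: power2_eq_square)

lemma cmod_square_sum: "(\<Sum>n\<in>A. c n * cnj (c n)) = of_real (\<Sum>n\<in>A. (cmod (c n))\<^sup>2)"
  by (simp add: complex_norm_square [symmetric] of_real_power [symmetric] del: of_real_power)

text \<open>Duality: pairing the adjoint with its own first \<open>N\<close> entries gives their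
  squared norm \<open>s\<close>, while Cauchy-Schwarz on the other side of the adjoint identity
  yields \<open>s^2 \<le> F * B * s\<close>.\<close>

lemma sqsum_dirichlet_adjoint_le:
  assumes a: "mult_bounded B a" and B: "B \<ge> 0" and af: "adjoint_summable a f" and F: "\<And>N. sqsum N f \<le> F"
  shows "sqsum N (dirichlet_adjoint a f) \<le> F * B"
proof (rule le_of_square_le_mult)
  let ?E = "dirichlet_adjoint a f"
  have s: "(\<lambda>m. f m * cnj ((a \<star> trunc N ?E) m)) sums of_real (sqsum N ?E)"
    using dirichlet_adjoint_sums [OF af, of N ?E] unfolding cmod_square_sum sqsum_def .
  have "(cmod (of_real (sqsum N ?E)))\<^sup>2 \<le> F * (B * sqsum N ?E)"
  proof (rule norm_sums_mult_cnj_le [OF s])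
    show "f 0 = 0" using af by (simp add: adjoint_summable_def)
    show "sqsum M (a \<star> trunc N ?E) \<le> B * sqsum N ?E" for M
    proof -
      have "sqsum M (a \<star> trunc N ?E) \<le> B * sqsum M (trunc N ?E)"
        using a by (simp add: mult_bounded_def)
      also have "\<dots> \<le> B * sqsum N ?E"
        using B by (intro mult_left_mono) (auto simp: sqsum_trunc intro: sqsum_mono)
      finally show ?thesis .
    qed
  qed (rule F)
  then show "(sqsum N ?E)\<^sup>2 \<le> sqsum N ?E * (F * B)" by (simp add: algebra_simps)
  show "0 \<le> F * B" using B F [of 0] by (simp add: sqsum_def)
qed simp

text \<open>The reverse duality, with the adjoint tested on \<open>a \<star> E\<close> itself, cut
  at \<open>N\<close>.\<close>

lemma mult_bounded_of_adjoint:
  assumes B: "B \<ge> 0"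
    and adj: "\<And>f N. sqsum N (dirichlet_adjoint a (trunc N f)) \<le> B * sqsum N f"
  shows "mult_bounded B a"
  unfolding mult_bounded_def
proof (intro allI, rule le_of_square_le_mult)
  fix E N
  let ?s = "sqsum N (a \<star> E)" and ?g = "dirichlet_adjoint a (trunc N (a \<star> E))"
  have "of_real ?s = (\<Sum>n=1..N. ?g n * cnj (E n))"
    using dirichlet_adjoint_trunc_sum [where f = "a \<star> E" and a = a and E = E and N = N] unfolding cmod_square_sum sqsum_def by simp
  then have "?s\<^sup>2 \<le> sqsum N ?g * sqsum N E"
    using norm_sum_mult_cnj_le [of ?g E "{1..N}"] unfolding sqsum_def [symmetric]
    by (metis norm_of_real power2_abs)
  also have "\<dots> \<le> B * ?s * sqsum N E"
    by (intro mult_right_mono adj) simp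
  finally show "?s\<^sup>2 \<le> ?s * (B * sqsum N E)" by (simp add: algebra_simps)
  show "0 \<le> B * sqsum N E" using B by simp
qed simp

text \<open>Adjoints reverse the order of \<open>b \<star> (a \<star> E) = E\<close>, and both
  operators stay within sequences supported on \<open>1..N\<close>. Entry \<open>n\<close> is read
  off by pairing with \<open>dirichlet_delta n\<close>.\<close>

lemma dirichlet_adjoint_inverse:
  assumes inv: "a \<star> b = dirichlet_one" and n: "n \<in> {1..N}"
  shows "dirichlet_adjoint a (trunc N (dirichlet_adjoint b (trunc N g))) n = g n"
proof -
  let ?E = "dirichlet_delta n"
  have pick: "(\<Sum>m=1..N. h m * cnj (?E m)) = h n" for h
  proof -
    have "(\<Sum>m=1..N. h m * cnj (?E m)) = (\<Sum>m=1..N. if m = n then h m else 0)"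
      by (rule sum.cong) (auto simp: dirichlet_delta_def)
    then show ?thesis using n by simp
  qed
  have E: "(b \<star> (a \<star> ?E)) m = ?E m" if "m > 0" for m
  proof -
    have "b \<star> (a \<star> ?E) = ?E \<star> dirichlet_one"
      using inv by (metis dirichlet_mult_assoc dirichlet_mult_comm)
    then show ?thesis using that by (simp add: dirichlet_mult_one_right)
  qed
  have "dirichlet_adjoint a (trunc N (dirichlet_adjoint b (trunc N g))) n =
      (\<Sum>m=1..N. dirichlet_adjoint b (trunc N g) m * cnj ((a \<star> ?E) m))"
    by (simp only: dirichlet_adjoint_trunc_sum pick)
  also have "\<dots> = (\<Sum>m=1..N. g m * cnj ((b \<star> (a \<star> ?E)) m))"
    by (rule dirichlet_adjoint_trunc_sum [symmetric])
  also have "\<dots> = (\<Sum>m=1..N. g m * cnj (?E m))"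
    by (rule sum.cong) (simp_all add: E)
  finally show ?thesis by (simp only: pick)
qed

text \<open>Every finite \<open>g\<close> is the adjoint of \<open>a\<close> applied to the adjoint
  of \<open>b\<close> at \<open>g\<close>. The lower bound for the former operator is therefore an
  upper bound for the latter.\<close>

lemma mult_bounded_inverse_of_adjoint:
  assumes inv: "a \<star> b = dirichlet_one" and A: "A > 0"
    and adj: "\<And>f N. A * sqsum N f \<le> sqsum N (dirichlet_adjoint a (trunc N f))"
  shows "mult_bounded (1 / A) b"
proof (rule mult_bounded_of_adjoint)
  fix g N
  have "sqsum N (dirichlet_adjoint a (trunc N (dirichlet_adjoint b (trunc N g)))) = sqsum N g"
    by (rule sqsum_cong) (rule dirichlet_adjoint_inverse [OF inv])
  then have "A * sqsum N (dirichlet_adjoint b (trunc N g)) \<le> sqsum N g"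
    using adj by metis
  then show "sqsum N (dirichlet_adjoint b (trunc N g)) \<le> 1 / A * sqsum N g"
    using A by (simp add: field_simps)
qed (use A in simp)

section \<open>Multipliers and bounded multiplication\<close>

lemma cmod_add_square_le: "(cmod (x + y))\<^sup>2 \<le> 2 * (cmod x)\<^sup>2 + 2 * (cmod y)\<^sup>2"
proof -
  have "(cmod (x + y))\<^sup>2 \<le> (cmod x + cmod y)\<^sup>2"
    by (intro power_mono norm_triangle_ineq) simp
  also have "\<dots> \<le> 2 * (cmod x)\<^sup>2 + 2 * (cmod y)\<^sup>2"
    using sum_squares_bound [of "cmod x" "cmod y"] by (simp add: power2_sum)
  finally show ?thesis .
qed

section \<open>Fejer means along the sum of prime factors\<close>

definition prime_factor_sum :: "nat \<Rightarrow> nat" where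
  "prime_factor_sum n = sum_mset (prime_factorization n)"

lemma prime_factor_sum_mult:
  "m > 0 \<Longrightarrow> n > 0 \<Longrightarrow> prime_factor_sum (m * n) = prime_factor_sum m + prime_factor_sum n"
  by (simp add: prime_factor_sum_def prime_factorization_mult)

text \<open>Multiply \<open>x \<le> 2 ^ x\<close> over the prime factors. Consequently only finitely
  many \<open>n\<close> have a prime factor sum below a given level.\<close>

lemma le_two_power_prime_factor_sum:
  assumes "n > 0"
  shows "n \<le> 2 ^ prime_factor_sum n"
proof -
  have "prod_mset A \<le> 2 ^ sum_mset A" for A :: "nat multiset"
  proof (induction A)
    case (add x A)
    have "x \<le> 2 ^ x" by (simp add: less_imp_le)
    then show ?case using mult_le_mono [OF _ add] by (simp add: power_add)
  qed simp
  from this [of "prime_factorization n"] show ?thesis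
    using assms by (simp add: prime_factor_sum_def prod_mset_prime_factorization_nat)
qed

text \<open>Subtraction on \<open>nat\<close> stops at 0 and so supplies the cut-off in the
  weight.\<close>

definition fejer_mean :: "nat \<Rightarrow> (nat \<Rightarrow> complex) \<Rightarrow> nat \<Rightarrow> complex" where
  "fejer_mean L b n = of_real (real (L - prime_factor_sum n) / real L) * b n"

lemma fejer_mean_tendsto: "(\<lambda>L. fejer_mean L b n) \<longlonglongrightarrow> b n"
proof -
  have "(\<lambda>L. 1 - real (prime_factor_sum n) / real L) \<longlonglongrightarrow> 1 - 0"
    by (intro tendsto_intros tendsto_divide_0 [OF tendsto_const]
        filterlim_at_top_imp_at_infinity filterlim_real_sequentially)
  moreover have "\<forall>\<^sub>F L in sequentially. 1 - real (prime_factor_sum n) / real L =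
      real (L - prime_factor_sum n) / real L"
    using eventually_ge_at_top [of "Suc (prime_factor_sum n)"]
    by eventually_elim (simp add: field_simps of_nat_diff)
  ultimately have "(\<lambda>L. real (L - prime_factor_sum n) / real L) \<longlonglongrightarrow> 1"
    by (simp add: Lim_transform_eventually)
  then have "(\<lambda>L. of_real (real (L - prime_factor_sum n) / real L) * b n) \<longlonglongrightarrow> of_real 1 * b n"
    by (intro tendsto_intros)
  then show ?thesis by (simp add: fejer_mean_def)
qed

text \<open>A Schur multiplier argument. The windows \<open>[h n, h n + L)\<close>, where
  \<open>h\<close> is the prime factor sum, overlap for \<open>d\<close> and \<open>d * e\<close> in
  exactly \<open>L - h e\<close> points. Hence \<open>L\<close> times the Fejer product is a sum
  over \<open>t\<close> of copies of multiplication by \<open>b\<close> cut down on both sides by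
  window indicators, and Cauchy-Schwarz in \<open>t\<close> transfers the bound.\<close>

lemma mult_bounded_fejer_mean:
  assumes b: "mult_bounded B b" and L: "L > 0"
  shows "mult_bounded B (fejer_mean L b)"
  unfolding mult_bounded_def
proof (intro allI)
  fix E N
  \<comment> \<open>Any bound beyond the ends of all windows with \<open>n \<le> N\<close> would
    do.\<close>
  define T where "T = (\<Sum>n=1..N. prime_factor_sum n) + L"
  define \<kappa> :: "nat \<Rightarrow> nat \<Rightarrow> complex" where
    "\<kappa> n t = (if prime_factor_sum n \<le> t \<and> t < prime_factor_sum n + L then 1 else 0)" for n t
  have T: "prime_factor_sum n + L \<le> T" if "n \<in> {1..N}" for n
    using that member_le_sum [of n "{1..N}" prime_factor_sum] by (simp add: T_def)
  have overlap: "(\<Sum>t<T. \<kappa> d t * \<kappa> (d * e) t) = of_nat (L - prime_factor_sum e)"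
    if "d > 0" "e > 0" "d * e \<in> {1..N}" for d e
  proof -
    let ?h = prime_factor_sum
    have h: "?h (d * e) = ?h d + ?h e" using that by (simp add: prime_factor_sum_mult)
    have "(\<Sum>t<T. \<kappa> d t * \<kappa> (d * e) t) = (\<Sum>t<T. if t \<in> {?h d + ?h e..<?h d + L} then 1 else 0)"
      by (rule sum.cong) (auto simp: \<kappa>_def h)
    also have "\<dots> = (\<Sum>t\<in>{..<T} \<inter> {?h d + ?h e..<?h d + L}. 1)"
      by (rule sum.inter_restrict [symmetric]) simp
    also have "{..<T} \<inter> {?h d + ?h e..<?h d + L} = {?h d + ?h e..<?h d + L}"
      using T [OF that(3)] h by auto
    finally show ?thesis by simp
  qed
  have window: "(\<Sum>t<T. (cmod (\<kappa> n t))\<^sup>2) = L" if "n \<in> {1..N}" for n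
  proof -
    have "of_real (\<Sum>t<T. (cmod (\<kappa> n t))\<^sup>2) = (\<Sum>t<T. \<kappa> n t * \<kappa> (n * 1) t)"
      by (simp add: \<kappa>_def if_distrib cong: if_cong) (rule sum.cong; simp)
    also have "\<dots> = of_real (real L)"
      using that by (subst overlap) (auto simp: prime_factor_sum_def)
    finally show ?thesis by (simp only: of_real_eq_iff)
  qed
  have slice: "of_nat L * (fejer_mean L b \<star> E) m = (\<Sum>t<T. (b \<star> (\<lambda>d. \<kappa> d t * E d)) m * cnj (\<kappa> m t))"
    if m: "m \<in> {1..N}" for m
  proof -
    have "of_nat L * (fejer_mean L b \<star> E) m =
        (\<Sum>d | d dvd m. E d * b (m div d) * of_nat (L - prime_factor_sum (m div d)))"
      using m L by (simp add: dirichlet_mult_def sum_distrib_left fejer_mean_def mult_ac)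
    also have "\<dots> = (\<Sum>d | d dvd m. E d * b (m div d) * (\<Sum>t<T. \<kappa> d t * \<kappa> m t))"
      by (rule sum.cong) (use m in \<open>auto simp: overlap elim!: dvdE\<close>)
    also have "\<dots> = (\<Sum>t<T. \<Sum>d | d dvd m. E d * b (m div d) * (\<kappa> d t * \<kappa> m t))"
      by (simp add: sum_distrib_left sum.swap [of _ "{d. d dvd m}"])
    also have "\<dots> = (\<Sum>t<T. (b \<star> (\<lambda>d. \<kappa> d t * E d)) m * cnj (\<kappa> m t))"
      using m by (auto simp: dirichlet_mult_def \<kappa>_def sum_distrib_right mult_ac intro!: sum.cong)
    finally show ?thesis .
  qed
  \<comment> \<open>Two factors \<open>L\<close> arise and cancel the square: one from
    Cauchy-Schwarz, as the window of \<open>m\<close> has \<open>L\<close> points, and one because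
    each \<open>n\<close> lies in the window for \<open>L\<close> values of
    \<open>t\<close>.\<close>
  have "(real L)\<^sup>2 * sqsum N (fejer_mean L b \<star> E) =
      (\<Sum>m=1..N. (cmod (of_nat L * (fejer_mean L b \<star> E) m))\<^sup>2)"
    by (simp add: sqsum_def sum_distrib_left norm_mult power_mult_distrib)
  also have "\<dots> \<le> (\<Sum>m=1..N. (\<Sum>t<T. (cmod ((b \<star> (\<lambda>d. \<kappa> d t * E d)) m))\<^sup>2) * L)"
  proof (rule sum_mono)
    fix m assume m: "m \<in> {1..N}"
    show "(cmod (of_nat L * (fejer_mean L b \<star> E) m))\<^sup>2 \<le>
        (\<Sum>t<T. (cmod ((b \<star> (\<lambda>d. \<kappa> d t * E d)) m))\<^sup>2) * L"
      using norm_sum_mult_cnj_le [of "\<lambda>t. (b \<star> (\<lambda>d. \<kappa> d t * E d)) m" "\<kappa> m" "{..<T}"]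
      unfolding slice [OF m] window [OF m] .
  qed
  also have "\<dots> = L * (\<Sum>t<T. sqsum N (b \<star> (\<lambda>d. \<kappa> d t * E d)))"
    unfolding sqsum_def by (subst sum.swap) (simp add: sum_distrib_left mult_ac)
  also have "\<dots> \<le> L * (\<Sum>t<T. B * sqsum N (\<lambda>d. \<kappa> d t * E d))"
    using b by (intro mult_left_mono sum_mono) (auto simp: mult_bounded_def)
  also have "\<dots> = L * (B * (\<Sum>n=1..N. (\<Sum>t<T. (cmod (\<kappa> n t))\<^sup>2) * (cmod (E n))\<^sup>2))"
    unfolding sqsum_def sum_distrib_left sum_distrib_right norm_mult power_mult_distrib
    by (subst sum.swap) (simp add: mult_ac)
  also have "\<dots> = L * (B * (L * sqsum N E))"
    by (simp add: window sqsum_def sum_distrib_left)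
  finally have "(real L)\<^sup>2 * sqsum N (fejer_mean L b \<star> E) \<le> (real L)\<^sup>2 * (B * sqsum N E)"
    by (simp add: power2_eq_square mult_ac)
  then show "sqsum N (fejer_mean L b \<star> E) \<le> B * sqsum N E"
    using L by simp
qed

text \<open>A nonzero term needs a divisor \<open>d \<le> M\<close> of \<open>n\<close> whose
  cofactor has prime factor sum below \<open>L\<close>, hence a cofactor of at most
  \<open>2 ^ L\<close>.\<close>

lemma fejer_mean_mult_trunc_support:
  assumes L: "L > 0" and n: "n > M * 2 ^ L"
  shows "(fejer_mean L b \<star> trunc M c) n = 0"
proof -
  have "trunc M c d * fejer_mean L b (n div d) = 0" if dvd: "d dvd n" for d
  proof (cases "d \<in> {1..M}")
    case True
    obtain e where e: "n = d * e" using dvd unfolding dvd_def by blast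
    then have "e > 0" using n by (cases e) auto
    have "\<not> e \<le> 2 ^ L"
      using True mult_le_mono [of d M e "2 ^ L"] e n by auto
    then have "\<not> prime_factor_sum e \<le> L"
      using le_two_power_prime_factor_sum [OF \<open>e > 0\<close>]
      by (meson le_trans one_le_numeral power_increasing)
    then show ?thesis using e True by (simp add: fejer_mean_def)
  qed (auto simp: trunc_def)
  then show ?thesis unfolding dirichlet_mult_def by (auto intro!: sum.neutral)
qed

section \<open>Closure properties of the Hardy space\<close>

lemma hardy_dirichlet_add:
  assumes "x \<in> hardy_dirichlet" "y \<in> hardy_dirichlet"
  shows "(\<lambda>n. x n + y n) \<in> hardy_dirichlet"
proof -
  obtain R S where R: "\<And>N. sqsum N x \<le> R" and S: "\<And>N. sqsum N y \<le> S"
    using assms by (auto simp: hardy_dirichlet_iff_sqsum)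
  have "sqsum N (\<lambda>n. x n + y n) \<le> 2 * R + 2 * S" for N
  proof -
    have "sqsum N (\<lambda>n. x n + y n) \<le> (\<Sum>n=1..N. 2 * (cmod (x n))\<^sup>2 + 2 * (cmod (y n))\<^sup>2)"
      unfolding sqsum_def
      by (intro sum_mono cmod_add_square_le)
    also have "\<dots> = 2 * sqsum N x + 2 * sqsum N y"
      by (simp add: sqsum_def sum.distrib sum_distrib_left)
    finally show ?thesis using R [of N] S [of N] by linarith
  qed
  then show ?thesis using assms by (auto simp: hardy_dirichlet_iff_sqsum)
qed

lemma sqsum_scale: "sqsum N (\<lambda>n. t * x n) = (cmod t)\<^sup>2 * sqsum N x"
  by (simp add: sqsum_def norm_mult power_mult_distrib sum_distrib_left)

lemma hardy_dirichlet_scale: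
  assumes "x \<in> hardy_dirichlet"
  shows "(\<lambda>n. t * x n) \<in> hardy_dirichlet"
proof -
  obtain R where "x 0 = 0" "\<And>N. sqsum N x \<le> R"
    using assms by (auto simp: hardy_dirichlet_iff_sqsum)
  then show ?thesis
    unfolding hardy_dirichlet_iff_sqsum sqsum_scale
    by (auto intro!: exI [of _ "(cmod t)\<^sup>2 * R"] mult_left_mono)
qed

lemma hardy_dirichlet_trunc: "trunc N c \<in> hardy_dirichlet"
  unfolding hardy_dirichlet_iff_sqsum sqsum_trunc
  by (auto simp: trunc_def intro!: exI [of _ "sqsum N c"] sqsum_mono)

lemma sqsum_mult_delta:
  assumes "m > 0"
  shows "sqsum (m * N) (x \<star> dirichlet_delta m) = sqsum N x"
proof -
  have "sqsum N x = (\<Sum>n\<in>(*) m ` {1..N}. (cmod (x (n div m)))\<^sup>2)"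
    unfolding sqsum_def
    by (subst sum.reindex) (use assms in \<open>auto simp: inj_on_def\<close>)
  also have "\<dots> = sqsum (m * N) (x \<star> dirichlet_delta m)"
    unfolding sqsum_def
  proof (rule sum.mono_neutral_cong_left)
    show "(*) m ` {1..N} \<subseteq> {1..m * N}"
      using assms by (auto simp: Suc_le_eq)
    show "\<forall>i\<in>{1..m * N} - (*) m ` {1..N}. (cmod ((x \<star> dirichlet_delta m) i))\<^sup>2 = 0"
      using assms by (auto simp: dirichlet_mult_delta_right image_iff Suc_le_eq elim!: dvdE)
  qed (use assms in \<open>auto simp: dirichlet_mult_delta_right\<close>)
  finally show ?thesis ..
qed

lemma hardy_dirichlet_mult_delta:
  assumes "x \<in> hardy_dirichlet" "m > 0"
  shows "x \<star> dirichlet_delta m \<in> hardy_dirichlet"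
proof -
  obtain R where R: "\<And>N. sqsum N x \<le> R"
    using assms by (auto simp: hardy_dirichlet_iff_sqsum)
  have "sqsum N (x \<star> dirichlet_delta m) \<le> R" for N
    using sqsum_mono [of N "m * N" "x \<star> dirichlet_delta m"] sqsum_mult_delta [of m N x] R [of N] assms
    by simp
  then show ?thesis by (auto simp: hardy_dirichlet_iff_sqsum)
qed

text \<open>A Dirichlet polynomial times \<open>a\<close> is a finite combination of index dilations
  of \<open>a\<close>. This holds even when multiplication by \<open>a\<close> is unbounded on the
  Hardy space.\<close>

lemma hardy_dirichlet_mult_trunc:
  assumes "a \<in> hardy_dirichlet"
  shows "a \<star> trunc M c \<in> hardy_dirichlet"
proof (induction M)
  case 0
  have "a \<star> trunc 0 c = trunc 0 c" by (rule ext) (simp add: dirichlet_mult_def trunc_def)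
  then show ?case by (simp add: hardy_dirichlet_trunc)
next
  case (Suc M)
  have "trunc (Suc M) c = (\<lambda>n. trunc M c n + c (Suc M) * dirichlet_delta (Suc M) n)"
    by (rule ext) (auto simp: trunc_def dirichlet_delta_def)
  then have "a \<star> trunc (Suc M) c = (\<lambda>n. (a \<star> trunc M c) n + c (Suc M) * (a \<star> dirichlet_delta (Suc M)) n)"
    by (simp add: dirichlet_mult_add_right dirichlet_mult_scale_right)
  then show ?case
    by (simp add: Suc hardy_dirichlet_add hardy_dirichlet_scale hardy_dirichlet_mult_delta assms)
qed

text \<open>The number \<open>s\<close> is the pairing of \<open>f\<close> with its truncation
  \<open>E\<close>. Replacing \<open>E\<close> by \<open>u L\<close> allows \<open>a\<close> to be
  moved onto \<open>f\<close>, where the bound \<open>R\<close> applies; the other factor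
  \<open>fejer_mean L b \<star> E\<close> has squared norm at most \<open>B * s\<close> on every
  initial segment. What remains is to let \<open>u L\<close> tend to \<open>E\<close>.\<close>

lemma sqsum_le_adjoint_of_inverse:
  assumes a: "a \<in> hardy_dirichlet" and f: "f \<in> hardy_dirichlet"
    and inv: "a \<star> b = dirichlet_one" and b: "mult_bounded B b" and B: "B \<ge> 0"
    and R: "\<And>N. sqsum N (dirichlet_adjoint a f) \<le> R"
  shows "sqsum M f \<le> R * B"
proof -
  define E where "E = trunc M f"
  define s where "s = sqsum M f"
  define g where "g = dirichlet_adjoint a f"
  define u where "u L = a \<star> (fejer_mean L b \<star> E)" for L
  have R0: "R \<ge> 0" using R [of 0] by (simp add: sqsum_def)
  have f0: "f 0 = 0" using f by (simp add: hardy_dirichlet_iff_sqsum)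
  have "a \<star> E \<in> hardy_dirichlet"
    unfolding E_def by (rule hardy_dirichlet_mult_trunc [OF a])
  then obtain Q where Q: "\<And>N. sqsum N (a \<star> E) \<le> Q"
    by (auto simp: hardy_dirichlet_iff_sqsum)
  \<comment> \<open>Regrouping lets the possibly unbounded \<open>a\<close> act on the finitely
    supported \<open>E\<close>, which gives a fixed element of the Hardy space; the Fejer factor is
    then bounded independently of \<open>L\<close>.\<close>
  have u_eq: "u L = fejer_mean L b \<star> (a \<star> E)" for L
    unfolding u_def by (metis dirichlet_mult_assoc dirichlet_mult_comm)
  have u_bound: "sqsum N (u L) \<le> B * Q" if "L > 0" for N L
  proof -
    have "sqsum N (u L) \<le> B * sqsum N (a \<star> E)"
      using mult_bounded_fejer_mean [OF b that] by (simp add: u_eq mult_bounded_def)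
    also have "\<dots> \<le> B * Q" using B Q by (intro mult_left_mono)
    finally show ?thesis .
  qed
  have u_lim: "(\<lambda>L. u L m) \<longlonglongrightarrow> E m" if "m > 0" for m
  proof -
    have "b \<star> (a \<star> E) = E \<star> dirichlet_one"
      using inv by (metis dirichlet_mult_assoc dirichlet_mult_comm)
    then have "E m = (b \<star> (a \<star> E)) m"
      using that by (simp add: dirichlet_mult_one_right)
    moreover have "(\<lambda>L. u L m) \<longlonglongrightarrow> (b \<star> (a \<star> E)) m"
      using that unfolding u_eq dirichlet_mult_def [of _ "a \<star> E"]
      by (auto intro!: tendsto_intros fejer_mean_tendsto)
    ultimately show ?thesis by simp
  qed
  define S where "S L = (\<Sum>n=1..M * 2 ^ L. g n * cnj ((fejer_mean L b \<star> E) n))" for L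
  have S_sums: "(\<lambda>m. f m * cnj (u L m)) sums S L" if "L > 0" for L
  proof -
    let ?P = "M * 2 ^ L"
    \<comment> \<open>Finite support of the right factor is what makes the adjoint identity
      applicable.\<close>
    have "fejer_mean L b \<star> E = trunc ?P (fejer_mean L b \<star> E)"
      using fejer_mean_mult_trunc_support [OF that, of M]
      by (auto simp: fun_eq_iff trunc_def E_def not_le Suc_le_eq)
    then show ?thesis
      using dirichlet_adjoint_sums [OF adjoint_summable_hardy [OF a f], of ?P "fejer_mean L b \<star> E"]
      by (simp add: u_def S_def g_def)
  qed
  have S_bound: "(cmod (S L))\<^sup>2 \<le> R * (B * s)" if "L > 0" for L
  proof -
    let ?P = "M * 2 ^ L"
    have "(cmod (S L))\<^sup>2 \<le> sqsum ?P g * sqsum ?P (fejer_mean L b \<star> E)"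
      unfolding S_def sqsum_def by (rule norm_sum_mult_cnj_le)
    also have "\<dots> \<le> R * (B * sqsum ?P E)"
      using mult_bounded_fejer_mean [OF b that] R R0 unfolding g_def
      by (intro mult_mono) (auto simp: mult_bounded_def)
    also have "\<dots> \<le> R * (B * s)"
      using R0 B by (intro mult_left_mono) (auto simp: E_def s_def sqsum_trunc intro: sqsum_mono)
    finally show ?thesis .
  qed
  have conv: "(\<lambda>N. sqsum N f) \<longlonglongrightarrow> (SUP N. sqsum N f)" and le_sup: "\<And>N. sqsum N f \<le> (SUP N. sqsum N f)"
  proof -
    have bdd: "bdd_above (range (\<lambda>N. sqsum N f))"
      using f by (auto simp: hardy_dirichlet_iff_sqsum bdd_above_def)
    show "(\<lambda>N. sqsum N f) \<longlonglongrightarrow> (SUP N. sqsum N f)"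
      by (rule LIMSEQ_incseq_SUP [OF bdd]) (simp add: incseq_def sqsum_mono)
    show "sqsum N f \<le> (SUP N. sqsum N f)" for N
      by (rule cSUP_upper [OF _ bdd]) simp
  qed
  \<comment> \<open>The squared norm of the tail of \<open>f\<close> beyond
    \<open>N\<close>.\<close>
  define \<tau> where "\<tau> N = (SUP N. sqsum N f) - sqsum N f" for N
  have head: "cmod (\<Sum>m=1..N. f m * cnj (u L m)) \<le> sqrt (R * (B * s)) + sqrt (\<tau> N * (B * Q))"
    if L: "L > 0" for N L
  proof -
    define v where "v m = (if m \<le> N then 0 else f m)" for m
    have sum_eq: "(\<Sum>m\<le>N. f m * cnj (u L m)) = (\<Sum>m=1..N. f m * cnj (u L m))"
      by (rule sum.mono_neutral_right) (use f0 in \<open>auto simp: not_less_eq_eq\<close>)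
    have "(\<lambda>m. if m \<in> {..N} then f m * cnj (u L m) else 0) sums (\<Sum>m\<le>N. f m * cnj (u L m))"
      by (rule sums_If_finite_set) simp
    from sums_diff [OF S_sums [OF L] this]
    have "(\<lambda>m. v m * cnj (u L m)) sums (S L - (\<Sum>m\<le>N. f m * cnj (u L m)))"
      by (rule sums_cong [THEN iffD1, rotated]) (simp add: v_def)
    then have "(cmod (S L - (\<Sum>m\<le>N. f m * cnj (u L m))))\<^sup>2 \<le> \<tau> N * (B * Q)"
    proof (rule norm_sums_mult_cnj_le)
      show "sqsum K v \<le> \<tau> N" for K
      proof (cases "K \<le> N")
        case True
        then have "sqsum K v = 0" by (simp add: sqsum_def v_def)
        then show ?thesis using le_sup [of N] by (simp add: \<tau>_def)
      next
        case False
        have "sqsum N f = sqsum K (\<lambda>m. f m - v m)"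
          using False sqsum_eq_of_support [of N "\<lambda>m. f m - v m" K] sqsum_cong [of N f "\<lambda>m. f m - v m"]
          by (simp add: v_def)
        then have "sqsum K v + sqsum N f = sqsum K f"
          by (simp add: sqsum_def v_def flip: sum.distrib) (rule sum.cong; simp add: v_def)
        then show ?thesis using le_sup [of K] by (simp add: \<tau>_def)
      qed
    qed (use u_bound [OF L] in \<open>auto simp: v_def\<close>)
    then have "cmod (S L - (\<Sum>m\<le>N. f m * cnj (u L m))) \<le> sqrt (\<tau> N * (B * Q))"
      by (rule real_le_rsqrt)
    moreover have "cmod (S L) \<le> sqrt (R * (B * s))"
      using S_bound [OF L] by (rule real_le_rsqrt)
    moreover have "cmod (\<Sum>m\<le>N. f m * cnj (u L m)) \<le>
        cmod (S L) + cmod (S L - (\<Sum>m\<le>N. f m * cnj (u L m)))"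
      by (metis norm_minus_commute norm_triangle_sub)
    ultimately show ?thesis unfolding sum_eq by linarith
  qed
  \<comment> \<open>First \<open>L\<close> tends to infinity with \<open>N\<close> fixed, so that
    coefficientwise convergence suffices. Then \<open>N\<close> does, which removes the tail and
    with it the uncontrolled constant \<open>Q\<close>.\<close>
  have "s \<le> sqrt (R * (B * s)) + sqrt (\<tau> N * (B * Q))" if N: "N \<ge> M" for N
  proof (rule LIMSEQ_le_const2)
    have "(\<lambda>L. cmod (\<Sum>m=1..N. f m * cnj (u L m))) \<longlonglongrightarrow> cmod (\<Sum>m=1..N. f m * cnj (E m))"
      by (intro tendsto_intros u_lim) auto
    also have "(\<Sum>m=1..N. f m * cnj (E m)) = (\<Sum>m=1..N. E m * cnj (E m))"
      by (rule sum.cong) (auto simp: E_def trunc_def)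
    also have "\<dots> = of_real s"
      using N unfolding cmod_square_sum sqsum_def [symmetric]
      by (simp add: s_def E_def sqsum_trunc min_absorb2)
    finally show "(\<lambda>L. cmod (\<Sum>m=1..N. f m * cnj (u L m))) \<longlonglongrightarrow> s"
      by (simp add: s_def)
    show "\<exists>L0. \<forall>L\<ge>L0. cmod (\<Sum>m=1..N. f m * cnj (u L m)) \<le> sqrt (R * (B * s)) + sqrt (\<tau> N * (B * Q))"
      using head by (intro exI [of _ 1]) auto
  qed
  moreover have "(\<lambda>N. sqrt (R * (B * s)) + sqrt (\<tau> N * (B * Q))) \<longlonglongrightarrow>
      sqrt (R * (B * s)) + sqrt (((SUP N. sqsum N f) - (SUP N. sqsum N f)) * (B * Q))"
    unfolding \<tau>_def by (intro tendsto_intros conv)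
  ultimately have "s \<le> sqrt (R * (B * s))"
    using LIMSEQ_le_const [of "\<lambda>N. sqrt (R * (B * s)) + sqrt (\<tau> N * (B * Q))"] by force
  then have "s\<^sup>2 \<le> (sqrt (R * (B * s)))\<^sup>2"
    by (rule power_mono) (simp add: s_def)
  also have "\<dots> = s * (R * B)"
    using R0 B by (simp add: s_def)
  finally have "s \<le> R * B"
    by (rule le_of_square_le_mult) (use R0 B in \<open>simp_all add: s_def\<close>)
  then show ?thesis by (simp add: s_def)
qed

section \<open>Multipliers are exactly the bounded multiplications\<close>

lemma multiplier_of_mult_bounded:
  assumes "D \<in> dirichlet_series" "mult_bounded B D" "B \<ge> 0"
  shows "D \<in> multipliers"
proof -
  have "D \<star> E \<in> hardy_dirichlet" if E: "E \<in> hardy_dirichlet" for E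
  proof -
    obtain R where R: "\<And>N. sqsum N E \<le> R"
      using E by (auto simp: hardy_dirichlet_iff_sqsum)
    have "sqsum N (D \<star> E) \<le> B * R" for N
      using assms(2) mult_left_mono [OF R assms(3)] by (fastforce simp: mult_bounded_def intro: order_trans)
    then show ?thesis by (auto simp: hardy_dirichlet_iff_sqsum)
  qed
  then show ?thesis using assms(1) by (simp add: multipliers_def)
qed

text \<open>Failure of the bound with constant \<open>C / \<epsilon>\<close> gives a block that can
  be rescaled to squared norm \<open>\<epsilon>\<close>, its image then having squared norm at least
  \<open>C\<close>. Rescaling needs a nonzero block, which triangularity guarantees.\<close>

lemma unbounded_mult_witness:
  assumes unb: "\<And>B. B \<ge> 0 \<Longrightarrow> \<not> mult_bounded B D" and \<epsilon>: "\<epsilon> > 0" and C: "C \<ge> 0"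
  obtains E N where "N > 0" "E = trunc N E" "sqsum N E \<le> \<epsilon>" "C \<le> sqsum N (D \<star> E)"
proof -
  have "\<not> mult_bounded (C / \<epsilon>) D" using unb \<epsilon> C by simp
  then obtain E N where E: "C / \<epsilon> * sqsum N E < sqsum N (D \<star> E)"
    by (auto simp: mult_bounded_def not_le)
  have q: "sqsum N E > 0"
  proof (rule ccontr)
    assume "\<not> ?thesis"
    then have "sqsum N E = 0" using sqsum_nonneg [of N E] by linarith
    then have "E n = 0" if "n \<in> {1..N}" for n
      using that by (auto simp: sqsum_def sum_nonneg_eq_0_iff)
    then have "(D \<star> E) n = (D \<star> (\<lambda>_. 0)) n" if "n \<in> {1..N}" for n
      using that by (intro dirichlet_mult_cong) auto
    then have "sqsum N (D \<star> E) = 0" by (simp add: sqsum_def dirichlet_mult_def)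
    then show False using E \<open>sqsum N E = 0\<close> by simp
  qed
  define t where "t = sqrt (\<epsilon> / sqsum N E)"
  have t2: "t\<^sup>2 = \<epsilon> / sqsum N E" using \<epsilon> q by (simp add: t_def)
  define E' where "E' = trunc N (\<lambda>n. of_real t * E n)"
  show thesis
  proof (rule that)
    show "N > 0" using q by (cases N) (auto simp: sqsum_def)
    show "E' = trunc N E'" by (auto simp: E'_def trunc_def)
    show "sqsum N E' \<le> \<epsilon>"
      using q by (simp add: E'_def sqsum_trunc sqsum_scale t2)
    have "sqsum N (D \<star> E') = t\<^sup>2 * sqsum N (D \<star> E)"
      by (simp add: E'_def sqsum_dirichlet_mult_trunc dirichlet_mult_scale_right sqsum_scale)
    moreover have "C \<le> t\<^sup>2 * sqsum N (D \<star> E)"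
      using E q \<epsilon> by (simp add: t2 field_simps)
    ultimately show "C \<le> sqsum N (D \<star> E')" by simp
  qed
qed

text \<open>A gliding hump: shifting by \<open>m\<^sup>-\<^sup>s\<close> commutes with multiplication by \<open>D\<close> and preserves norms,
  so finite blocks on which \<open>D\<close> acts with large norm can be moved past everything built so far.\<close>
lemma mult_bounded_of_multiplier:
  assumes D: "D \<in> multipliers"
  obtains B where "B \<ge> 0" "mult_bounded B D"
proof (rule ccontr)
  assume "\<not> thesis"
  then have unb: "\<not> mult_bounded B D" if "B \<ge> 0" for B using that \<open>\<And>B. \<lbrakk>0 \<le> B; mult_bounded B D\<rbrakk> \<Longrightarrow> thesis\<close> by blast
  \<comment> \<open>Stage \<open>j\<close> is a polynomial supported on \<open>1..M\<close> whose
    image has squared norm at least \<open>j\<close>. Passing to the next stage keeps the old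
    coefficients and costs at most \<open>(1 / 2) ^ j\<close> in squared norm, so the total cost
    stays bounded.\<close>
  define P :: "nat \<Rightarrow> (nat \<Rightarrow> complex) \<times> nat \<Rightarrow> bool" where
    "P j = (\<lambda>(F, M). F = trunc M F \<and> j \<le> M \<and> real j \<le> sqsum M (D \<star> F))" for j
  define Q :: "nat \<Rightarrow> (nat \<Rightarrow> complex) \<times> nat \<Rightarrow> (nat \<Rightarrow> complex) \<times> nat \<Rightarrow> bool" where
    "Q j = (\<lambda>(F, M) (F', M'). M \<le> M' \<and> (\<forall>n\<le>M. F' n = F n) \<and>
        sqsum M' F' \<le> sqsum M F + (1 / 2) ^ j)" for j
  have "\<exists>x. \<forall>j. P j (x j) \<and> Q j (x j) (x (Suc j))"
  proof (rule dependent_nat_choice)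
    show "\<exists>x. P 0 x"
      by (rule exI [of _ "(\<lambda>_. 0, 0)"]) (auto simp: P_def trunc_def)
  next
    fix x j assume "P j x"
    then obtain F M where x: "x = (F, M)" and F: "F = trunc M F" and M: "j \<le> M"
      by (cases x) (auto simp: P_def)
    have "D \<star> F \<in> hardy_dirichlet"
      using D hardy_dirichlet_trunc [of M F] F by (simp add: multipliers_def)
    then obtain R where R: "\<And>N. sqsum N (D \<star> F) \<le> R"
      by (auto simp: hardy_dirichlet_iff_sqsum)
    then have "R \<ge> 0" using sqsum_nonneg order_trans by blast
    \<comment> \<open>The estimate \<open>|H|^2 / 2 - |DF|^2 \<le> |DF + H|^2\<close> halves the
      image of the new block and loses at most \<open>R\<close> to the old part; this constant
      leaves \<open>Suc j\<close>.\<close>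
    then have C: "0 \<le> 2 * R + 2 * real (Suc j)" by simp
    have \<epsilon>: "(0::real) < (1 / 2) ^ j" by simp
    obtain E N where N: "N > 0" and E: "E = trunc N E" "sqsum N E \<le> (1 / 2) ^ j"
        and DE: "2 * R + 2 * real (Suc j) \<le> sqsum N (D \<star> E)"
      by (rule unbounded_mult_witness [OF unb \<epsilon> C])
    \<comment> \<open>Every positive multiple of \<open>Suc M\<close> exceeds \<open>M\<close>, so
      the shifted block avoids the support of \<open>F\<close>.\<close>
    define m where "m = Suc M"
    define G where "G = E \<star> dirichlet_delta m"
    define F' where "F' n = F n + G n" for n
    have m: "m > 0" by (simp add: m_def)
    have G_low: "G n = 0" if "n \<le> M" for n
      using that by (auto simp: G_def m_def dirichlet_mult_delta_right dest: dvd_imp_le)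
    then have F'_low: "F' n = F n" if "n \<le> M" for n
      using that by (simp add: F'_def)
    have G_high: "G n = 0" if "n > m * N" for n
    proof -
      have "E (n div m) = 0" if "m dvd n"
        using that \<open>n > m * N\<close> by (subst E(1)) (auto simp: trunc_def elim!: dvdE)
      then show ?thesis using m by (simp add: G_def dirichlet_mult_delta_right)
    qed
    have F_high: "F n = 0" if "n > M" for n
      using that by (subst F) (simp add: trunc_def)
    have MN: "M < m * N" using N by (cases N) (auto simp: m_def)
    have F0: "F 0 = 0" by (subst F) (simp add: trunc_def)
    have "P (Suc j) (F', m * N)"
    proof -
      have "F' = trunc (m * N) F'"
        using F0 G_low [of 0] F_high G_high MN by (auto simp: F'_def trunc_def fun_eq_iff not_le Suc_le_eq)
      moreover have "real (Suc j) \<le> sqsum (m * N) (D \<star> F')"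
      proof -
        let ?H = "(D \<star> E) \<star> dirichlet_delta m"
        have eq: "D \<star> F' = (\<lambda>n. (D \<star> F) n + ?H n)"
          unfolding F'_def G_def by (simp add: dirichlet_mult_add_right dirichlet_mult_assoc)
        have "real (Suc j) \<le> sqsum (m * N) ?H / 2 - sqsum (m * N) (D \<star> F)"
          using DE R [of "m * N"] sqsum_mult_delta [OF m, of N "D \<star> E"] by simp
        also have "sqsum (m * N) ?H / 2 - sqsum (m * N) (D \<star> F) \<le>
            sqsum (m * N) (\<lambda>n. (D \<star> F) n + ?H n)"
        proof -
          have "(cmod (?H n))\<^sup>2 / 2 - (cmod ((D \<star> F) n))\<^sup>2 \<le> (cmod ((D \<star> F) n + ?H n))\<^sup>2" for n
          proof -
            have "(cmod (?H n))\<^sup>2 \<le> 2 * (cmod ((D \<star> F) n + ?H n))\<^sup>2 + 2 * (cmod (- (D \<star> F) n))\<^sup>2"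
              using cmod_add_square_le [of "(D \<star> F) n + ?H n" "- (D \<star> F) n"] by simp
            then show ?thesis by simp
          qed
          then show ?thesis
            unfolding sqsum_def sum_divide_distrib sum_subtractf [symmetric] by (intro sum_mono)
        qed
        finally show ?thesis unfolding eq .
      qed
      ultimately show ?thesis using MN M by (simp add: P_def)
    qed
    moreover have "Q j x (F', m * N)"
    proof -
      have "sqsum (m * N) F' = sqsum (m * N) F + sqsum (m * N) G"
        unfolding sqsum_def sum.distrib [symmetric]
      proof (rule sum.cong)
        show "(cmod (F' n))\<^sup>2 = (cmod (F n))\<^sup>2 + (cmod (G n))\<^sup>2" for n
          using G_low [of n] F_high [of n] by (cases "n \<le> M") (auto simp: F'_def)
      qed simp
      also have "sqsum (m * N) F = sqsum M F"
        using F_high MN by (intro sqsum_eq_of_support) auto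
      also have "sqsum (m * N) G = sqsum N E"
        unfolding G_def by (rule sqsum_mult_delta [OF m])
      finally show ?thesis
        using E(2) MN F'_low by (simp add: Q_def x)
    qed
    ultimately show "\<exists>y. P (Suc j) y \<and> Q j x y" by blast
  qed
  then obtain x where P: "\<And>j. P j (x j)" and Q: "\<And>j. Q j (x j) (x (Suc j))" by blast
  define F where "F j = fst (x j)" for j
  define M where "M j = snd (x j)" for j
  have F: "F j = trunc (M j) (F j)" "j \<le> M j" "real j \<le> sqsum (M j) (D \<star> F j)" for j
    using P [of j] by (auto simp: P_def F_def M_def split: prod.splits)
  have M_Suc: "M j \<le> M (Suc j)" and F_Suc: "\<And>n. n \<le> M j \<Longrightarrow> F (Suc j) n = F j n"
    and sq_Suc: "sqsum (M (Suc j)) (F (Suc j)) \<le> sqsum (M j) (F j) + (1 / 2) ^ j" for j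
    using Q [of j] by (auto simp: Q_def F_def M_def split: prod.splits)
  have M_mono: "M i \<le> M j" if "i \<le> j" for i j
    using that M_Suc by (rule lift_Suc_mono_le [rotated])
  have stable: "F (j + k) n = F j n" if "n \<le> M j" for j k n
  proof (induction k)
    case (Suc k)
    have "n \<le> M (j + k)" using that M_mono [of j "j + k"] by simp
    then show ?case using F_Suc [of n "j + k"] Suc by simp
  qed simp
  \<comment> \<open>Since \<open>n \<le> M n\<close>, the coefficient at \<open>n\<close> is final
    from stage \<open>n\<close> on.\<close>
  define G where "G n = F n n" for n
  have G: "G n = F j n" if "n \<le> M j" for n j
  proof (cases "n \<le> j")
    case True
    then show ?thesis using stable [of n n "j - n"] F(2) [of n] by (simp add: G_def)
  next
    case False
    then show ?thesis using stable [of n j "n - j"] that by (simp add: G_def)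
  qed
  have sqF: "sqsum (M j) (F j) \<le> sqsum (M 0) (F 0) + (\<Sum>i<j. (1 / 2) ^ i)" for j
  proof (induction j)
    case (Suc j)
    then show ?case using sq_Suc [of j] by simp
  qed simp
  have geo: "(\<Sum>i<j. (1 / 2 :: real) ^ i) \<le> 2" for j
    by (simp add: sum_gp_strict)
  have "sqsum N G \<le> sqsum (M 0) (F 0) + 2" for N
  proof -
    have "sqsum N G \<le> sqsum (M N) G" using F(2) by (rule sqsum_mono)
    also have "\<dots> = sqsum (M N) (F N)" by (rule sqsum_cong) (simp add: G)
    finally show ?thesis using sqF [of N] geo [of N] by linarith
  qed
  moreover have "G 0 = 0" unfolding G_def by (subst F(1)) (simp add: trunc_def)
  ultimately have "G \<in> hardy_dirichlet" by (auto simp: hardy_dirichlet_iff_sqsum)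
  then have "D \<star> G \<in> hardy_dirichlet" using D by (simp add: multipliers_def)
  then obtain R where R: "\<And>N. sqsum N (D \<star> G) \<le> R"
    by (auto simp: hardy_dirichlet_iff_sqsum)
  obtain j where "real j > R" using reals_Archimedean2 by blast
  moreover have "sqsum (M j) (D \<star> G) = sqsum (M j) (D \<star> F j)"
    by (intro sqsum_cong dirichlet_mult_cong) (simp add: G)
  ultimately show False using R [of "M j"] F(3) [of j] by linarith
qed

section \<open>The sine basis of \<open>L\<^sup>2(0,1)\<close>\<close>

abbreviation unit_interval :: "real measure" where
  "unit_interval \<equiv> lebesgue_on {0<..<1}"

lemma borel_measurable_unit_interval_continuous:
  fixes f :: "real \<Rightarrow> 'a::euclidean_space"
  shows "continuous_on UNIV f \<Longrightarrow> f \<in> borel_measurable unit_interval"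
  by (rule continuous_imp_measurable_on_sets_lebesgue) (auto intro: continuous_on_subset)

lemma integrable_unit_interval_bounded:
  fixes f :: "real \<Rightarrow> 'a::euclidean_space"
  assumes "f \<in> borel_measurable unit_interval" "\<And>x. norm (f x) \<le> B"
  shows "integrable unit_interval f"
proof -
  interpret finite_measure unit_interval by (rule finite_measure_lebesgue_on) simp
  show ?thesis using assms by (intro integrable_const_bound) auto
qed

section \<open>Inner product and Cauchy-Schwarz for functions on the unit interval\<close>

definition L2_sq :: "(real \<Rightarrow> complex) \<Rightarrow> real" where
  "L2_sq f = (LINT x|unit_interval. (cmod (f x))\<^sup>2)"

lemma L2_norm_square: "(L2_norm f)\<^sup>2 = L2_sq f"
  by (simp add: L2_norm_def L2_sq_def)

lemma L2_01_measurable: "f \<in> L2_01 \<Longrightarrow> f \<in> borel_measurable unit_interval"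
  by (simp add: L2_01_def)

lemma L2_01_integrable: "f \<in> L2_01 \<Longrightarrow> integrable unit_interval (\<lambda>x. (cmod (f x))\<^sup>2)"
  by (simp add: L2_01_def)

lemma L2_01_bounded:
  assumes "f \<in> borel_measurable unit_interval" "\<And>x. cmod (f x) \<le> B"
  shows "f \<in> L2_01"
proof -
  have "integrable unit_interval (\<lambda>x. (cmod (f x))\<^sup>2)"
    using assms by (intro integrable_unit_interval_bounded [of _ "B\<^sup>2"]) (auto intro: power_mono)
  then show ?thesis using assms by (simp add: L2_01_def)
qed

lemma L2_01_add:
  assumes "f \<in> L2_01" "g \<in> L2_01"
  shows "(\<lambda>x. f x + g x) \<in> L2_01"
proof -
  have m: "(\<lambda>x. f x + g x) \<in> borel_measurable unit_interval"
    using assms by (intro borel_measurable_add L2_01_measurable)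
  have "integrable unit_interval (\<lambda>x. 2 * (cmod (f x))\<^sup>2 + 2 * (cmod (g x))\<^sup>2)"
    using assms by (intro Bochner_Integration.integrable_add integrable_mult_right L2_01_integrable)
  then have "integrable unit_interval (\<lambda>x. (cmod (f x + g x))\<^sup>2)"
    by (rule Bochner_Integration.integrable_bound) (use m in \<open>auto simp: cmod_add_square_le\<close>)
  then show ?thesis using m by (simp add: L2_01_def)
qed

lemma L2_01_scale: "f \<in> L2_01 \<Longrightarrow> (\<lambda>x. c * f x) \<in> L2_01"
  by (auto simp: L2_01_def norm_mult power_mult_distrib)

lemma L2_01_diff: "f \<in> L2_01 \<Longrightarrow> g \<in> L2_01 \<Longrightarrow> (\<lambda>x. f x - g x) \<in> L2_01"
  using L2_01_add [of f "\<lambda>x. (-1) * g x"] L2_01_scale [of g "-1"] by simp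

lemma L2_01_zero: "(\<lambda>x. 0) \<in> L2_01"
  by (rule L2_01_bounded [of _ 0]) auto

lemma L2_01_sum:
  "(\<And>i. i \<in> A \<Longrightarrow> f i \<in> L2_01) \<Longrightarrow> (\<lambda>x. \<Sum>i\<in>A. f i x) \<in> L2_01"
  by (induction A rule: infinite_finite_induct) (auto simp: L2_01_zero intro: L2_01_add)

lemma integrable_mult_cnj:
  assumes f: "f \<in> L2_01" and g: "g \<in> L2_01"
  shows "integrable unit_interval (\<lambda>x. f x * cnj (g x))"
proof -
  have [measurable]: "f \<in> borel_measurable unit_interval" "g \<in> borel_measurable unit_interval"
    using assms by (simp_all add: L2_01_measurable)
  have "integrable unit_interval (\<lambda>x. (cmod (f x))\<^sup>2 + (cmod (g x))\<^sup>2)"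
    using assms by (intro Bochner_Integration.integrable_add L2_01_integrable)
  then show ?thesis
  proof (rule Bochner_Integration.integrable_bound)
    show "(\<lambda>x. f x * cnj (g x)) \<in> borel_measurable unit_interval"
      by (intro borel_measurable_times borel_measurable_continuous_on [OF continuous_on_cnj])
        (auto intro: continuous_intros)
    have "cmod (f x * cnj (g x)) \<le> (cmod (f x))\<^sup>2 + (cmod (g x))\<^sup>2" for x
    proof -
      have "2 * (cmod (f x) * cmod (g x)) \<le> (cmod (f x))\<^sup>2 + (cmod (g x))\<^sup>2"
        using sum_squares_bound [of "cmod (f x)" "cmod (g x)"] by (simp add: mult.assoc)
      moreover have "0 \<le> cmod (f x) * cmod (g x)" by simp
      ultimately show ?thesis unfolding norm_mult complex_mod_cnj by linarith
    qed
    then show "AE x in unit_interval. norm (f x * cnj (g x)) \<le> norm ((cmod (f x))\<^sup>2 + (cmod (g x))\<^sup>2)"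
      by simp
  qed
qed

lemma L2_inner_diff_left:
  "f \<in> L2_01 \<Longrightarrow> g \<in> L2_01 \<Longrightarrow> h \<in> L2_01 \<Longrightarrow>
    L2_inner (\<lambda>x. f x - g x) h = L2_inner f h - L2_inner g h"
  unfolding L2_inner_def left_diff_distrib
  by (intro Bochner_Integration.integral_diff integrable_mult_cnj)

lemma L2_inner_scale_left: "L2_inner (\<lambda>x. c * f x) h = c * L2_inner f h"
  by (simp add: L2_inner_def mult.assoc)

lemma L2_inner_sum_left:
  assumes "\<And>i. i \<in> A \<Longrightarrow> f i \<in> L2_01" "h \<in> L2_01"
  shows "L2_inner (\<lambda>x. \<Sum>i\<in>A. f i x) h = (\<Sum>i\<in>A. L2_inner (f i) h)"
  unfolding L2_inner_def sum_distrib_right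
  by (intro Bochner_Integration.integral_sum integrable_mult_cnj assms)

lemma L2_inner_commute: "cnj (L2_inner f g) = L2_inner g f"
  by (simp add: L2_inner_def mult.commute flip: Bochner_Integration.integral_cnj)

lemma L2_inner_diff_right:
  "f \<in> L2_01 \<Longrightarrow> g \<in> L2_01 \<Longrightarrow> h \<in> L2_01 \<Longrightarrow>
    L2_inner h (\<lambda>x. f x - g x) = L2_inner h f - L2_inner h g"
  using L2_inner_diff_left [of f g h] by (metis L2_inner_commute complex_cnj_diff)

lemma L2_inner_self: "L2_inner f f = of_real (L2_sq f)"
  unfolding L2_inner_def L2_sq_def
  by (simp add: complex_norm_square [symmetric] flip: integral_complex_of_real)

lemma L2_sq_nonneg: "0 \<le> L2_sq f"
  by (simp add: L2_sq_def)

lemma L2_sq_diff: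
  assumes "f \<in> L2_01" "g \<in> L2_01"
  shows "L2_sq (\<lambda>x. f x - g x) = L2_sq f - 2 * Re (L2_inner f g) + L2_sq g"
proof -
  have "complex_of_real (L2_sq (\<lambda>x. f x - g x)) =
      of_real (L2_sq f) - (L2_inner f g + L2_inner g f) + of_real (L2_sq g)"
    unfolding L2_inner_self [symmetric]
    using assms by (simp add: L2_inner_diff_left L2_inner_diff_right L2_01_diff)
  also have "L2_inner f g + L2_inner g f = of_real (2 * Re (L2_inner f g))"
    using complex_add_cnj [of "L2_inner f g"] by (simp add: L2_inner_commute)
  finally have "complex_of_real (L2_sq (\<lambda>x. f x - g x)) =
      of_real (L2_sq f - 2 * Re (L2_inner f g) + L2_sq g)"
    by simp
  then show ?thesis by (simp only: of_real_eq_iff)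
qed

text \<open>Expand the squared norm of \<open>f - t * I * g\<close> for real \<open>t\<close>, with
  \<open>I\<close> the inner product. The minimising choice is \<open>t = 1 / L2_sq g\<close>; if
  \<open>L2_sq g = 0\<close>, a large \<open>t\<close> forces \<open>I = 0\<close>.\<close>

lemma L2_Cauchy_Schwarz:
  assumes f: "f \<in> L2_01" and g: "g \<in> L2_01"
  shows "(cmod (L2_inner f g))\<^sup>2 \<le> L2_sq f * L2_sq g"
proof -
  define I where "I = L2_inner f g"
  have key: "2 * t * (cmod I)\<^sup>2 \<le> L2_sq f + t\<^sup>2 * (cmod I)\<^sup>2 * L2_sq g" for t :: real
  proof -
    let ?h = "\<lambda>x. (of_real t * I) * g x"
    have "L2_inner f ?h = of_real t * (I * cnj I)"
      by (subst L2_inner_commute [symmetric], subst L2_inner_scale_left)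
        (simp add: L2_inner_commute I_def mult_ac)
    then have "Re (L2_inner f ?h) = t * (cmod I)\<^sup>2"
      by (simp add: complex_norm_square [symmetric] del: complex_mult_cnj)
    moreover have "L2_sq ?h = t\<^sup>2 * (cmod I)\<^sup>2 * L2_sq g"
      by (simp add: L2_sq_def norm_mult power_mult_distrib)
    moreover have "0 \<le> L2_sq f - 2 * Re (L2_inner f ?h) + L2_sq ?h"
      using L2_sq_nonneg L2_sq_diff [OF f L2_01_scale [OF g]] by metis
    ultimately show ?thesis by simp
  qed
  show ?thesis
  proof (cases "L2_sq g = 0")
    case True
    have "(cmod I)\<^sup>2 \<le> 0"
    proof (rule ccontr)
      assume "\<not> ?thesis"
      then have pos: "(cmod I)\<^sup>2 > 0" by simp
      show False
        using key [of "(L2_sq f + 1) / (cmod I)\<^sup>2"] pos True L2_sq_nonneg [of f] by simp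
    qed
    then show ?thesis using True by (simp add: I_def)
  next
    case False
    then have "L2_sq g > 0" using L2_sq_nonneg [of g] by linarith
    then have "(cmod I)\<^sup>2 / L2_sq g \<le> L2_sq f"
      using key [of "1 / L2_sq g"] by (simp add: power2_eq_square)
    then show ?thesis using \<open>L2_sq g > 0\<close> by (simp add: I_def field_simps)
  qed
qed

section \<open>Orthonormality of the sine system\<close>

lemma continuous_on_sine_basis: "continuous_on A (sine_basis n)"
  unfolding sine_basis_def [abs_def] by (intro continuous_intros)

lemma cmod_sine_basis_le: "cmod (sine_basis n x) \<le> sqrt 2"
  by (simp add: sine_basis_def norm_mult abs_mult mult_left_le)

lemma sine_basis_L2_01: "sine_basis n \<in> L2_01"
  by (rule L2_01_bounded [OF borel_measurable_unit_interval_continuous [OF continuous_on_sine_basis]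
        cmod_sine_basis_le])

lemma integral_cos_pi:
  "(LINT x|unit_interval. cos (pi * of_int k * x)) = (if k = 0 then 1 else 0)"
proof -
  have int: "integrable unit_interval (\<lambda>x. cos (pi * of_int k * x))"
    by (rule integrable_unit_interval_bounded [of _ 1])
      (auto intro!: borel_measurable_unit_interval_continuous continuous_intros)
  show ?thesis
  proof (cases "k = 0")
    case False
    have "((\<lambda>x. cos (pi * of_int k * x)) has_integral
        (sin (pi * of_int k * 1) / (pi * of_int k) - sin (pi * of_int k * 0) / (pi * of_int k))) {0..1}"
    proof (rule fundamental_theorem_of_calculus)
      show "((\<lambda>x. sin (pi * of_int k * x) / (pi * of_int k)) has_vector_derivative
          cos (pi * of_int k * x)) (at x within {0..1})" for x
        unfolding has_real_derivative_iff_has_vector_derivative [symmetric]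
        by (rule derivative_eq_intros refl | use False in simp)+
    qed simp
    then have "((\<lambda>x. cos (pi * of_int k * x)) has_integral 0) {0<..<1}"
      by (simp add: has_integral_Icc_iff_Ioo del: minus_mult_right)
    then show ?thesis
      using False by (simp add: lebesgue_integral_eq_integral [OF int] integral_unique)
  qed (simp add: measure_restrict_space)
qed

text \<open>A product of sines is a difference of cosines of frequencies \<open>n - m\<close> and
  \<open>n + m\<close>. The latter is nonzero, so only the former can contribute.\<close>

lemma sine_basis_orthonormal:
  assumes "n > 0" "m > 0"
  shows "L2_inner (sine_basis n) (sine_basis m) = (if n = m then 1 else 0)"
proof -
  have eq: "sine_basis n x * cnj (sine_basis m x) =
      of_real (cos (pi * of_int (int n - int m) * x) - cos (pi * of_int (int n + int m) * x))" for x
  proof -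
    have "sqrt 2 * sin (pi * n * x) * (sqrt 2 * sin (pi * m * x)) =
        cos (pi * n * x - pi * m * x) - cos (pi * n * x + pi * m * x)"
      by (simp add: cos_add cos_diff)
    also have "\<dots> = cos (pi * of_int (int n - int m) * x) - cos (pi * of_int (int n + int m) * x)"
      by (simp add: algebra_simps)
    finally show ?thesis
      by (simp only: sine_basis_def complex_cnj_complex_of_real of_real_mult [symmetric])
  qed
  have "integrable unit_interval (\<lambda>x. cos (pi * of_int k * x))" for k
    by (rule integrable_unit_interval_bounded [of _ 1])
      (auto intro!: borel_measurable_unit_interval_continuous continuous_intros)
  then have "(LINT x|unit_interval. cos (pi * of_int (int n - int m) * x) - cos (pi * of_int (int n + int m) * x))
      = (if n = m then 1 else 0)"
    using assms by (subst Bochner_Integration.integral_diff) (simp_all only: integral_cos_pi, auto)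
  then show ?thesis
    unfolding L2_inner_def eq integral_complex_of_real by simp
qed

section \<open>Finite sine sums and their distance to a function\<close>

definition sine_sum :: "(nat \<Rightarrow> complex) \<Rightarrow> nat \<Rightarrow> real \<Rightarrow> complex" where
  "sine_sum c N x = (\<Sum>n=1..N. c n * sine_basis n x)"

lemma sine_sum_L2_01: "sine_sum c N \<in> L2_01"
  unfolding sine_sum_def [abs_def] by (intro L2_01_sum L2_01_scale sine_basis_L2_01)

lemma L2_inner_sine_sum_left:
  assumes "f \<in> L2_01"
  shows "L2_inner (sine_sum c N) f = (\<Sum>n=1..N. c n * cnj (S_transform f n))"
proof -
  have "L2_inner (sine_sum c N) f = (\<Sum>n=1..N. L2_inner (\<lambda>x. c n * sine_basis n x) f)"
    unfolding sine_sum_def [abs_def]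
    by (intro L2_inner_sum_left L2_01_scale sine_basis_L2_01 assms)
  also have "\<dots> = (\<Sum>n=1..N. c n * cnj (S_transform f n))"
    by (rule sum.cong) (auto simp: L2_inner_scale_left S_transform_def L2_inner_commute)
  finally show ?thesis .
qed

lemma S_transform_sine_sum: "S_transform (sine_sum c N) n = (if n \<in> {1..N} then c n else 0)"
proof (cases "n = 0")
  case False
  have "L2_inner (sine_sum c N) (sine_basis n) = (\<Sum>k=1..N. c k * cnj (L2_inner (sine_basis n) (sine_basis k)))"
    unfolding L2_inner_sine_sum_left [OF sine_basis_L2_01] by (rule sum.cong) (auto simp: S_transform_def)
  also have "\<dots> = (\<Sum>k=1..N. if k = n then c k else 0)"
    by (rule sum.cong) (use False in \<open>auto simp: sine_basis_orthonormal\<close>)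
  finally show ?thesis using False by (simp add: S_transform_def)
qed (simp add: S_transform_def)

text \<open>Completing the square. The case \<open>c = S_transform f\<close> is Bessel's inequality,
  and nonnegativity of the last sum is the best approximation property.\<close>

lemma L2_sq_diff_sine_sum:
  assumes f: "f \<in> L2_01"
  shows "L2_sq (\<lambda>x. f x - sine_sum c N x) =
    L2_sq f - (\<Sum>n=1..N. (cmod (S_transform f n))\<^sup>2) + (\<Sum>n=1..N. (cmod (S_transform f n - c n))\<^sup>2)"
proof -
  let ?p = "sine_sum c N" and ?s = "S_transform f"
  note [simp] = sine_sum_L2_01 f
  have pf: "L2_inner ?p f = (\<Sum>n=1..N. c n * cnj (?s n))"
    by (simp add: L2_inner_sine_sum_left)
  have fp: "L2_inner f ?p = (\<Sum>n=1..N. ?s n * cnj (c n))"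
    by (subst L2_inner_commute [symmetric]) (simp add: pf mult.commute)
  have pp: "L2_inner ?p ?p = (\<Sum>n=1..N. c n * cnj (c n))"
    by (simp add: L2_inner_sine_sum_left S_transform_sine_sum)
  have "complex_of_real (L2_sq (\<lambda>x. f x - ?p x)) =
      of_real (L2_sq f) - L2_inner ?p f - L2_inner f ?p + L2_inner ?p ?p"
    unfolding L2_inner_self [symmetric]
    by (simp add: L2_inner_diff_left L2_inner_diff_right L2_01_diff)
  also have "\<dots> = of_real (L2_sq f) - (\<Sum>n=1..N. ?s n * cnj (?s n)) +
      (\<Sum>n=1..N. (?s n - c n) * cnj (?s n - c n))"
    unfolding pf fp pp by (simp add: algebra_simps sum.distrib sum_subtractf)
  also have "\<dots> = of_real (L2_sq f - (\<Sum>n=1..N. (cmod (?s n))\<^sup>2) + (\<Sum>n=1..N. (cmod (?s n - c n))\<^sup>2))"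
    by (simp add: complex_norm_square [symmetric] del: complex_cnj_diff)
  finally show ?thesis by (simp only: of_real_eq_iff)
qed

section \<open>Density of sine polynomials\<close>

definition sine_polynomials :: "(real \<Rightarrow> complex) set" where
  "sine_polynomials = {sine_sum c N | c N. True}"

lemma sine_polynomials_L2_01: "q \<in> sine_polynomials \<Longrightarrow> q \<in> L2_01"
  by (auto simp: sine_polynomials_def sine_sum_L2_01)

lemma sine_polynomials_zero: "(\<lambda>x. 0) \<in> sine_polynomials"
proof -
  have "(\<lambda>x. 0) = sine_sum (\<lambda>_. 0) 0" by (simp add: sine_sum_def fun_eq_iff)
  then show ?thesis by (auto simp: sine_polynomials_def)
qed

lemma sine_polynomials_add:
  assumes "f \<in> sine_polynomials" "g \<in> sine_polynomials"
  shows "(\<lambda>x. f x + g x) \<in> sine_polynomials"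
proof -
  have ext: "sine_sum c N = sine_sum (\<lambda>n. if n \<le> N then c n else 0) (max N M)" for c N M
  proof
    fix x
    have "sine_sum c N x = (\<Sum>n=1..N. (if n \<le> N then c n else 0) * sine_basis n x)"
      unfolding sine_sum_def by (rule sum.cong) auto
    also have "\<dots> = (\<Sum>n=1..max N M. (if n \<le> N then c n else 0) * sine_basis n x)"
      by (rule sum.mono_neutral_left) auto
    finally show "sine_sum c N x = sine_sum (\<lambda>n. if n \<le> N then c n else 0) (max N M) x"
      by (simp add: sine_sum_def)
  qed
  obtain c N d M where f: "f = sine_sum c N" and g: "g = sine_sum d M"
    using assms by (auto simp: sine_polynomials_def)
  have "(\<lambda>x. f x + g x) =
      sine_sum (\<lambda>n. (if n \<le> N then c n else 0) + (if n \<le> M then d n else 0)) (max N M)"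
    unfolding f g ext [of c N M] ext [of d M N] max.commute [of M N]
    by (simp add: sine_sum_def fun_eq_iff distrib_right sum.distrib)
  then show ?thesis by (auto simp: sine_polynomials_def)
qed

lemma sine_polynomials_scale:
  assumes "f \<in> sine_polynomials"
  shows "(\<lambda>x. t * f x) \<in> sine_polynomials"
proof -
  obtain c N where f: "f = sine_sum c N" using assms by (auto simp: sine_polynomials_def)
  have "(\<lambda>x. t * f x) = sine_sum (\<lambda>n. t * c n) N"
    by (simp add: f sine_sum_def fun_eq_iff sum_distrib_left mult.assoc)
  then show ?thesis by (auto simp: sine_polynomials_def)
qed

lemma sine_polynomials_sum:
  "(\<And>i. i \<in> A \<Longrightarrow> f i \<in> sine_polynomials) \<Longrightarrow> (\<lambda>x. \<Sum>i\<in>A. f i x) \<in> sine_polynomials"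
  by (induction A rule: infinite_finite_induct)
    (auto simp: sine_polynomials_zero intro: sine_polynomials_add)

lemma sine_basis_in_sine_polynomials: "sine_basis n \<in> sine_polynomials"
proof (cases "n = 0")
  case True
  then have "sine_basis n = (\<lambda>x. 0)" by (simp add: sine_basis_def fun_eq_iff)
  then show ?thesis by (simp add: sine_polynomials_zero)
next
  case False
  have "sine_basis n = sine_sum (\<lambda>k. if k = n then 1 else 0) n"
  proof
    fix x
    have "sine_sum (\<lambda>k. if k = n then 1 else 0) n x = (\<Sum>k=1..n. if k = n then sine_basis k x else 0)"
      unfolding sine_sum_def by (rule sum.cong) auto
    then show "sine_basis n x = sine_sum (\<lambda>k. if k = n then 1 else 0) n x"
      using False by simp
  qed
  then show ?thesis by (auto simp: sine_polynomials_def)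
qed

text \<open>Multiplication by the cosine averages the two neighbouring frequencies; for
  \<open>n = 1\<close> the lower neighbour \<open>sine_basis 0\<close> is the zero function.\<close>

lemma sine_polynomials_mult_cos:
  assumes "f \<in> sine_polynomials"
  shows "(\<lambda>x. f x * of_real (cos (pi * x))) \<in> sine_polynomials"
proof -
  obtain c N where f: "f = sine_sum c N" using assms by (auto simp: sine_polynomials_def)
  have shift: "sine_basis n x * of_real (cos (pi * x)) =
      1 / 2 * (sine_basis (n + 1) x + sine_basis (n - 1) x)" if "n > 0" for n x
  proof -
    have "sin (pi * n * x) * cos (pi * x) = (sin (pi * n * x + pi * x) + sin (pi * n * x - pi * x)) / 2"
      by (simp add: sin_add sin_diff)
    also have "\<dots> = (sin (pi * real (n + 1) * x) + sin (pi * real (n - 1) * x)) / 2"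
      using that by (simp add: algebra_simps of_nat_diff)
    finally have "sqrt 2 * sin (pi * n * x) * cos (pi * x) =
        sqrt 2 * ((sin (pi * real (n + 1) * x) + sin (pi * real (n - 1) * x)) / 2)"
      by (simp only: mult.assoc)
    also have "\<dots> = 1 / 2 * (sqrt 2 * sin (pi * real (n + 1) * x) + sqrt 2 * sin (pi * real (n - 1) * x))"
      by (simp add: distrib_left)
    finally show ?thesis
      unfolding sine_basis_def by (simp only: of_real_mult [symmetric] of_real_add [symmetric]) simp
  qed
  have "(\<lambda>x. f x * of_real (cos (pi * x))) =
      (\<lambda>x. \<Sum>n=1..N. c n * (1 / 2 * (sine_basis (n + 1) x + sine_basis (n - 1) x)))"
    unfolding f sine_sum_def sum_distrib_right by (intro ext sum.cong) (auto simp: mult.assoc shift)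
  also have "\<dots> \<in> sine_polynomials"
    by (intro sine_polynomials_sum sine_polynomials_scale sine_polynomials_add sine_basis_in_sine_polynomials)
  finally show ?thesis .
qed

lemma sine_polynomials_sin_mult_polynomial:
  assumes "real_polynomial_function p"
  shows "(\<lambda>x. of_real (sin (pi * x) * p (cos (pi * x)))) \<in> sine_polynomials"
proof -
  have pow: "(\<lambda>x. of_real (sin (pi * x) * cos (pi * x) ^ i)) \<in> sine_polynomials" for i
  proof (induction i)
    case 0
    have "(\<lambda>x. of_real (sin (pi * x) * cos (pi * x) ^ 0)) = (\<lambda>x. of_real (1 / sqrt 2) * sine_basis 1 x)"
      by (simp add: sine_basis_def fun_eq_iff)
    then show ?case by (simp only: sine_polynomials_scale sine_basis_in_sine_polynomials)
  next
    case (Suc i)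
    then show ?case using sine_polynomials_mult_cos by (force simp: mult_ac)
  qed
  obtain a k where "p = (\<lambda>x. \<Sum>i\<le>k. a i * x ^ i)"
    using assms real_polynomial_function_iff_sum by blast
  then have "(\<lambda>x. complex_of_real (sin (pi * x) * p (cos (pi * x)))) =
      (\<lambda>x. \<Sum>i\<le>k. of_real (a i) * of_real (sin (pi * x) * cos (pi * x) ^ i))"
    by (simp add: sum_distrib_left mult_ac)
  then show ?thesis by (simp only: sine_polynomials_sum sine_polynomials_scale pow)
qed

text \<open>The substitution \<open>t = cos (pi * x)\<close> carries \<open>[0,1]\<close> to
  \<open>[-1,1]\<close>, where Weierstrass approximates the real and imaginary parts of
  \<open>h\<close> by polynomials. The factor \<open>sin (pi * x)\<close> turns a polynomial in the
  cosine into a sine polynomial.\<close>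

lemma sine_polynomials_uniform_approx:
  fixes h :: "real \<Rightarrow> complex"
  assumes h: "continuous_on {0..1} h" and e: "e > 0"
  obtains q where "q \<in> sine_polynomials"
    "\<And>x. x \<in> {0..1} \<Longrightarrow> cmod (of_real (sin (pi * x)) * h x - q x) \<le> e"
proof -
  define H where "H t = h (arccos t / pi)" for t
  have "continuous_on {-1..1} H"
    unfolding H_def
    by (rule continuous_on_compose2 [OF h])
      (auto intro!: continuous_intros continuous_on_arccos' simp: arccos_lbound arccos_ubound)
  then have "continuous_on {-1..1} (\<lambda>t. Re (H t))" "continuous_on {-1..1} (\<lambda>t. Im (H t))"
    by (intro continuous_intros; assumption)+
  then obtain p r where p: "real_polynomial_function p" "\<And>t. t \<in> {-1..1} \<Longrightarrow> \<bar>Re (H t) - p t\<bar> < e / 2"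
      and r: "real_polynomial_function r" "\<And>t. t \<in> {-1..1} \<Longrightarrow> \<bar>Im (H t) - r t\<bar> < e / 2"
    using Stone_Weierstrass_real_polynomial_function [of "{-1..1}" _ "e / 2"] e
    by (metis compact_Icc half_gt_zero)
  define q where "q x = of_real (sin (pi * x) * p (cos (pi * x))) +
      \<i> * of_real (sin (pi * x) * r (cos (pi * x)))" for x
  show thesis
  proof (rule that)
    show "q \<in> sine_polynomials"
      unfolding q_def using p(1) r(1)
      by (intro sine_polynomials_add sine_polynomials_scale sine_polynomials_sin_mult_polynomial)
    fix x :: real assume x: "x \<in> {0..1}"
    define t where "t = cos (pi * x)"
    have t: "t \<in> {-1..1}" by (simp add: t_def)
    have "arccos t = pi * x" unfolding t_def using x by (intro arccos_cos) auto
    then have h_eq: "h x = H t" by (simp add: H_def)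
    have "of_real (sin (pi * x)) * h x - q x = of_real (sin (pi * x)) *
        (of_real (Re (H t) - p t) + \<i> * of_real (Im (H t) - r t))"
      unfolding h_eq q_def t_def [symmetric] by (simp add: complex_eq_iff algebra_simps)
    also have "cmod \<dots> \<le> 1 * (e / 2 + e / 2)"
      unfolding norm_mult
    proof (intro mult_mono order_trans [OF norm_triangle_ineq] add_mono)
      show "cmod (of_real (Re (H t) - p t)) \<le> e / 2"
        unfolding norm_of_real using p(2) [OF t] by simp
      show "cmod (\<i> * of_real (Im (H t) - r t)) \<le> e / 2"
        unfolding norm_mult norm_of_real using r(2) [OF t] by simp
    qed auto
    finally show "cmod (of_real (sin (pi * x)) * h x - q x) \<le> e" by simp
  qed
qed

text \<open>Measurable functions are almost everywhere limits of continuous functions \<open>g\<^sub>n\<close>; these are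
  clamped, and damped near the endpoints, so that the limit becomes dominated and the damped
  functions can be divided by \<open>sin (\<pi> x)\<close>.\<close>
lemma sine_polynomials_L2_approx_bounded:
  assumes f: "f \<in> borel_measurable unit_interval" and B: "\<And>x. cmod (f x) \<le> B" and e: "e > 0"
  shows "\<exists>q\<in>sine_polynomials. L2_sq (\<lambda>x. f x - q x) < e"
proof -
  have "f measurable_on {0<..<1}"
    using f by (simp add: measurable_on_iff_borel_measurable)
  then obtain Z g where Z: "negligible Z" and g: "\<And>n. continuous_on UNIV (g n)"
      and lim: "\<And>x. x \<notin> Z \<Longrightarrow> (\<lambda>n. g n x) \<longlonglongrightarrow> (if x \<in> {0<..<1} then f x else 0)"
    unfolding measurable_on_def by metis
  define R where "R = B + 1"
  have R: "R > 0" using B [of 0] norm_ge_zero [of "f 0"] unfolding R_def by linarith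
  \<comment> \<open>The radial retraction onto the disc of radius \<open>R\<close>. Taking
    \<open>R = B + 1\<close> keeps the radius positive when \<open>B = 0\<close>.\<close>
  define \<kappa> :: "complex \<Rightarrow> complex" where "\<kappa> z = z / of_real (max 1 (cmod z / R))" for z
  have \<kappa>_cont: "continuous_on UNIV \<kappa>"
    unfolding \<kappa>_def using R by (intro continuous_intros) auto
  have \<kappa>_bound: "cmod (\<kappa> z) \<le> R" for z
    using R by (auto simp: \<kappa>_def norm_divide max_def field_simps)
  have \<kappa>_id: "\<kappa> z = z" if "cmod z \<le> B" for z
    using R that by (simp add: \<kappa>_def max_def R_def field_simps)
  define \<delta> where "\<delta> n = inverse (real (Suc n))" for n
  have \<delta>: "\<delta> n > 0" "\<delta> n \<le> 1" for n
    by (simp_all add: \<delta>_def field_simps)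
  \<comment> \<open>The denominator is at least \<open>\<delta> n\<close>, so \<open>h n\<close> is
    continuous up to the endpoints; at each interior point it equals \<open>sin (pi * x)\<close> for
    large \<open>n\<close>, and the damping disappears.\<close>
  define h where "h n x = \<kappa> (g n x) / of_real (max (sin (pi * x)) (\<delta> n))" for n x
  have h_cont: "continuous_on {0..1} (h n)" for n
    unfolding h_def using \<delta>(1) [of n]
    by (intro continuous_intros continuous_on_compose2 [OF \<kappa>_cont] continuous_on_subset [OF g]) auto
  have "\<exists>q\<in>sine_polynomials. \<forall>x\<in>{0..1}. cmod (of_real (sin (pi * x)) * h n x - q x) \<le> \<delta> n" for n
    by (rule sine_polynomials_uniform_approx [OF h_cont \<delta>(1), of n]) blast
  then obtain q where q: "\<And>n. q n \<in> sine_polynomials"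
      and qh: "\<And>n x. x \<in> {0..1} \<Longrightarrow> cmod (of_real (sin (pi * x)) * h n x - q n x) \<le> \<delta> n"
    by metis
  have sh: "cmod (of_real (sin (pi * x)) * h n x) \<le> R" if "x \<in> {0..1}" for n x
  proof -
    have "0 \<le> sin (pi * x)" using that by (intro sin_ge_zero) auto
    then have "\<bar>sin (pi * x)\<bar> / \<bar>max (sin (pi * x)) (\<delta> n)\<bar> \<le> 1"
      using \<delta>(1) [of n] by (simp add: max_def field_simps)
    then have "\<bar>sin (pi * x)\<bar> / \<bar>max (sin (pi * x)) (\<delta> n)\<bar> * cmod (\<kappa> (g n x)) \<le> 1 * R"
      using \<kappa>_bound R by (intro mult_mono) auto
    then show ?thesis by (simp add: h_def norm_mult norm_divide)
  qed
  have q_lim: "(\<lambda>n. q n x) \<longlonglongrightarrow> f x" if x: "x \<in> {0<..<1}" "x \<notin> Z" for x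
  proof -
    have pos: "sin (pi * x) > 0" using x by (intro sin_gt_zero) auto
    have \<delta>_lim: "\<delta> \<longlonglongrightarrow> 0"
      unfolding \<delta>_def by (rule LIMSEQ_inverse_real_of_nat)
    then have "\<forall>\<^sub>F n in sequentially. \<delta> n < sin (pi * x)"
      by (rule order_tendstoD) (rule pos)
    then have ev: "\<forall>\<^sub>F n in sequentially. \<kappa> (g n x) = of_real (sin (pi * x)) * h n x"
      by eventually_elim (use pos in \<open>simp add: h_def max_def\<close>)
    have "isCont \<kappa> (f x)" using \<kappa>_cont by (simp add: continuous_on_eq_continuous_at)
    moreover have "(\<lambda>n. g n x) \<longlonglongrightarrow> f x" using lim [OF x(2)] x(1) by simp
    ultimately have "(\<lambda>n. \<kappa> (g n x)) \<longlonglongrightarrow> \<kappa> (f x)"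
      by (rule isCont_tendsto_compose)
    then have "(\<lambda>n. \<kappa> (g n x)) \<longlonglongrightarrow> f x" by (simp add: \<kappa>_id B)
    then have 1: "(\<lambda>n. of_real (sin (pi * x)) * h n x) \<longlonglongrightarrow> f x"
      using ev by (rule Lim_transform_eventually)
    have "(\<lambda>n. of_real (sin (pi * x)) * h n x - q n x) \<longlonglongrightarrow> 0"
    proof (rule Lim_null_comparison [OF _ \<delta>_lim], rule always_eventually, rule allI)
      show "norm (of_real (sin (pi * x)) * h n x - q n x) \<le> \<delta> n" for n
        using x(1) by (intro qh) simp
    qed
    from tendsto_diff [OF 1 this] show ?thesis by simp
  qed
  have q_bound: "cmod (f x - q n x) \<le> B + (R + 1)" if "x \<in> {0..1}" for n x
  proof -
    have "cmod (q n x) \<le> cmod (of_real (sin (pi * x)) * h n x) + cmod (of_real (sin (pi * x)) * h n x - q n x)"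
      by (metis norm_minus_commute norm_triangle_sub)
    also have "\<dots> \<le> R + 1"
      using sh [OF that, of n] qh [OF that, of n] \<delta>(2) [of n] by linarith
    finally show ?thesis
      using norm_triangle_ineq4 [of "f x" "q n x"] B [of x] by linarith
  qed
  have "(\<lambda>n. L2_sq (\<lambda>x. f x - q n x)) \<longlonglongrightarrow> (LINT x|unit_interval. (0::real))"
    unfolding L2_sq_def
  proof (rule integral_dominated_convergence)
    show "integrable unit_interval (\<lambda>x. (B + (R + 1))\<^sup>2)"
      by (rule integrable_unit_interval_bounded [of _ "(B + (R + 1))\<^sup>2"]) auto
    show "(\<lambda>x. (cmod (f x - q n x))\<^sup>2) \<in> borel_measurable unit_interval" for n
      using f L2_01_measurable [OF sine_polynomials_L2_01 [OF q]] by measurable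
    have "AE x in lebesgue. x \<notin> Z"
      using Z by (simp add: negligible_iff_null_sets AE_not_in)
    then have "AE x in unit_interval. x \<notin> Z"
      by (auto simp: AE_restrict_space_iff)
    moreover have "AE x in unit_interval. x \<in> {0<..<1}"
      by (auto intro: AE_I2)
    ultimately show "AE x in unit_interval. (\<lambda>n. (cmod (f x - q n x))\<^sup>2) \<longlonglongrightarrow> 0"
    proof eventually_elim
      case (elim x)
      have "(\<lambda>n. (cmod (f x - q n x))\<^sup>2) \<longlonglongrightarrow> (cmod (f x - f x))\<^sup>2"
        by (intro tendsto_intros q_lim elim)
      then show ?case by simp
    qed
    show "AE x in unit_interval. norm ((cmod (f x - q n x))\<^sup>2) \<le> (B + (R + 1))\<^sup>2" for n
      by (rule AE_I2) (use q_bound in \<open>auto intro!: power_mono\<close>)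
  qed simp
  then have "\<forall>\<^sub>F n in sequentially. L2_sq (\<lambda>x. f x - q n x) < e"
    using e by (intro order_tendstoD) auto
  then show ?thesis using q eventually_happens' sequentially_bot by blast
qed

lemma L2_sq_add_le:
  assumes "f \<in> L2_01" "g \<in> L2_01"
  shows "L2_sq (\<lambda>x. f x + g x) \<le> 2 * L2_sq f + 2 * L2_sq g"
proof -
  have "L2_sq (\<lambda>x. f x + g x) \<le> (LINT x|unit_interval. 2 * (cmod (f x))\<^sup>2 + 2 * (cmod (g x))\<^sup>2)"
    unfolding L2_sq_def
    using assms by (intro integral_mono) (auto simp: cmod_add_square_le L2_01_integrable L2_01_add)
  also have "\<dots> = 2 * L2_sq f + 2 * L2_sq g"
    using assms by (simp add: L2_sq_def L2_01_integrable)
  finally show ?thesis .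
qed

text \<open>Cutting \<open>f\<close> off where it is large reduces to the bounded case. Each of the
  two errors is below \<open>e / 4\<close> because \<open>L2_sq_add_le\<close> doubles both.\<close>

lemma sine_polynomials_L2_approx:
  assumes f: "f \<in> L2_01" and e: "e > 0"
  shows "\<exists>q\<in>sine_polynomials. L2_sq (\<lambda>x. f x - q x) < e"
proof -
  define F where "F k x = (if cmod (f x) \<le> real k then f x else 0)" for k x
  have [measurable]: "f \<in> borel_measurable unit_interval"
    using f by (rule L2_01_measurable)
  have F_meas: "F k \<in> borel_measurable unit_interval" for k
    unfolding F_def [abs_def] by measurable
  have F_bound: "cmod (F k x) \<le> real k" for k x
    by (simp add: F_def)
  have F_L2: "F k \<in> L2_01" for k
    using F_meas F_bound by (rule L2_01_bounded)
  have "(\<lambda>k. L2_sq (\<lambda>x. f x - F k x)) \<longlonglongrightarrow> (LINT x|unit_interval. (0::real))"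
    unfolding L2_sq_def
  proof (rule integral_dominated_convergence)
    show "integrable unit_interval (\<lambda>x. (cmod (f x))\<^sup>2)"
      using f by (rule L2_01_integrable)
    show "(\<lambda>x. (cmod (f x - F k x))\<^sup>2) \<in> borel_measurable unit_interval" for k
      using F_meas [of k] by measurable
    have "(\<lambda>k. (cmod (f x - F k x))\<^sup>2) \<longlonglongrightarrow> 0" for x
    proof (rule tendsto_eventually)
      obtain k0 :: nat where "cmod (f x) \<le> real k0" using real_arch_simple by blast
      then show "\<forall>\<^sub>F k in sequentially. (cmod (f x - F k x))\<^sup>2 = 0"
        unfolding eventually_sequentially F_def by (intro exI [of _ k0]) auto
    qed
    then show "AE x in unit_interval. (\<lambda>k. (cmod (f x - F k x))\<^sup>2) \<longlonglongrightarrow> 0" by simp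
    show "AE x in unit_interval. norm ((cmod (f x - F k x))\<^sup>2) \<le> (cmod (f x))\<^sup>2" for k
      by (simp add: F_def)
  qed simp
  then have "\<forall>\<^sub>F k in sequentially. L2_sq (\<lambda>x. f x - F k x) < e / 4"
    using e by (intro order_tendstoD) auto
  then obtain k where k: "L2_sq (\<lambda>x. f x - F k x) < e / 4"
    using eventually_happens' sequentially_bot by blast
  obtain q where q: "q \<in> sine_polynomials" "L2_sq (\<lambda>x. F k x - q x) < e / 4"
    using sine_polynomials_L2_approx_bounded [OF F_meas F_bound, of "e / 4" k] e by auto
  have "L2_sq (\<lambda>x. f x - q x) \<le> 2 * L2_sq (\<lambda>x. f x - F k x) + 2 * L2_sq (\<lambda>x. F k x - q x)"
    using L2_sq_add_le [OF L2_01_diff [OF f F_L2 [of k]] L2_01_diff [OF F_L2 [of k] sine_polynomials_L2_01 [OF q(1)]]]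
    by simp
  then have "L2_sq (\<lambda>x. f x - q x) < e" using k q(2) by linarith
  then show ?thesis using q(1) by blast
qed

section \<open>Bessel's inequality and completeness\<close>

lemma Bessel_inequality:
  assumes "f \<in> L2_01"
  shows "(\<Sum>n=1..N. (cmod (S_transform f n))\<^sup>2) \<le> L2_sq f"
  using L2_sq_diff_sine_sum [OF assms, of "S_transform f" N]
    L2_sq_nonneg [of "\<lambda>x. f x - sine_sum (S_transform f) N x"] by simp

text \<open>Once \<open>N \<ge> M\<close>, the partial sum is at least as close to \<open>f\<close>
  as any sine polynomial of degree \<open>M\<close>, so density gives convergence.\<close>

lemma L2_sq_diff_partial_sums_tendsto:
  assumes f: "f \<in> L2_01"
  shows "(\<lambda>N. L2_sq (\<lambda>x. f x - sine_sum (S_transform f) N x)) \<longlonglongrightarrow> 0"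
proof (rule LIMSEQ_I)
  fix e :: real assume e: "e > 0"
  obtain q where "q \<in> sine_polynomials" and q: "L2_sq (\<lambda>x. f x - q x) < e"
    using sine_polynomials_L2_approx [OF f e] by blast
  then obtain c M where qc: "q = sine_sum c M" by (auto simp: sine_polynomials_def)
  have "L2_sq (\<lambda>x. f x - sine_sum (S_transform f) N x) < e" if "N \<ge> M" for N
  proof -
    have "(\<Sum>n=1..M. (cmod (S_transform f n))\<^sup>2) \<le> (\<Sum>n=1..N. (cmod (S_transform f n))\<^sup>2)"
      using that by (intro sum_mono2) auto
    then have "L2_sq (\<lambda>x. f x - sine_sum (S_transform f) N x) \<le> L2_sq (\<lambda>x. f x - q x)"
      unfolding qc L2_sq_diff_sine_sum [OF f] by (simp add: add_increasing2 sum_nonneg)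
    then show ?thesis using q by simp
  qed
  then show "\<exists>N0. \<forall>N\<ge>N0. norm (L2_sq (\<lambda>x. f x - sine_sum (S_transform f) N x) - 0) < e"
    by (auto simp: L2_sq_nonneg)
qed

lemma Parseval:
  assumes f: "f \<in> L2_01"
  shows "(\<lambda>N. \<Sum>n=1..N. (cmod (S_transform f n))\<^sup>2) \<longlonglongrightarrow> L2_sq f"
  using tendsto_diff [OF tendsto_const [of "L2_sq f"] L2_sq_diff_partial_sums_tendsto [OF f]]
  by (simp add: L2_sq_diff_sine_sum [OF f])

section \<open>Dilations\<close>

text \<open>Sine sums are already odd and 2-periodic on the whole line, so dilating one merely
  multiplies its frequencies.\<close>

lemma odd_periodic_ext_sine_sum: "odd_periodic_ext (sine_sum c N) = sine_sum c N"
proof (rule odd_periodic_ext_unique [symmetric])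
  have "sine_basis n (x + 2) = sine_basis n x" for n x
  proof -
    have "sin (pi * n * (x + 2)) = sin (pi * n * x + 2 * pi * n)"
      by (simp add: algebra_simps)
    also have "\<dots> = sin (pi * n * x)"
      using sin_int_2pin [of "int n"] cos_int_2pin [of "int n"] by (simp add: sin_add)
    finally show ?thesis by (simp add: sine_basis_def)
  qed
  then show "sine_sum c N (x + 2) = sine_sum c N x" for x
    by (simp add: sine_sum_def)
  show "sine_sum c N (- x) = - sine_sum c N x" for x
    by (simp add: sine_sum_def sine_basis_def sum_negf)
qed simp

lemma dilation_system_sine_sum:
  "dilation_system (sine_sum c N) n x = (\<Sum>k=1..N. c k * sine_basis (n * k) x)"
  by (simp add: dilation_system_def odd_periodic_ext_sine_sum)
    (simp add: sine_sum_def sine_basis_def mult_ac)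

lemma dilation_system_diff:
  "dilation_system (\<lambda>x. f x - g x) n x = dilation_system f n x - dilation_system g n x"
  by (simp add: dilation_system_def odd_periodic_ext_def Let_def)

text \<open>On \<open>[j, j + 1]\<close> the extension is a translate of \<open>\<phi>\<close> for even \<open>j\<close> and, up to sign, a reflected
  translate for odd \<open>j\<close>.  At the integers themselves it vanishes.\<close>
definition fold_unit :: "nat \<Rightarrow> real \<Rightarrow> real" where
  "fold_unit j y = (if even j then y - real j else real j + 1 - y)"

lemma odd_periodic_ext_piece:
  assumes "real j \<le> y" "y < real j + 1"
  shows "odd_periodic_ext \<phi> y =
    (-1) ^ j * (if fold_unit j y \<in> {0<..<1} then \<phi> (fold_unit j y) else 0)"
proof (cases "even j")
  case True
  then obtain k where k: "j = 2 * k" by blast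
  have "odd_periodic_ext \<phi> y = (let z = y - 2 * of_int (int k)
      in if 0 < z then \<phi> z else if -1 < z \<and> z < 0 then - \<phi> (- z) else 0)"
    using assms k by (intro odd_periodic_ext_reduce) auto
  then show ?thesis using assms k by (simp add: fold_unit_def)
next
  case False
  then obtain k where k: "j = 2 * k + 1" by (blast elim: oddE)
  have "odd_periodic_ext \<phi> y = (let z = y - 2 * of_int (int k + 1)
      in if 0 < z then \<phi> z else if -1 < z \<and> z < 0 then - \<phi> (- z) else 0)"
    using assms k by (intro odd_periodic_ext_reduce) auto
  then show ?thesis using assms k by (auto simp: fold_unit_def algebra_simps)
qed

lemma fold_unit_in_unit_interval: "fold_unit j y \<in> {0<..<1} \<longleftrightarrow> real j < y \<and> y < real j + 1"
  by (auto simp: fold_unit_def)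

text \<open>For \<open>x\<close> in the unit interval at most one piece is nonzero at
  \<open>n * x\<close>, so squared moduli add as well. Outside it all \<open>n\<close> pieces
  vanish; the second identity thus holds on the whole line and can be integrated there.\<close>

lemma
  fixes \<phi> :: "real \<Rightarrow> complex"
  assumes n: "n > 0"
  defines "\<phi>0 \<equiv> \<lambda>x. if x \<in> {0<..<1} then \<phi> x else 0"
  shows dilation_system_pieces: "x \<in> {0<..<1} \<Longrightarrow>
      dilation_system \<phi> n x = (\<Sum>j<n. (-1) ^ j * \<phi>0 (fold_unit j (real n * x)))" (is "_ \<Longrightarrow> ?A")
    and cmod_dilation_system_pieces: "(if x \<in> {0<..<1} then (cmod (dilation_system \<phi> n x))\<^sup>2 else 0) =
      (\<Sum>j<n. (cmod (\<phi>0 (fold_unit j (real n * x))))\<^sup>2)" (is ?B)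
proof -
  have zero: "\<phi>0 (fold_unit j y) = 0" if "\<not> (real j < y \<and> y < real j + 1)" for j y
    using that fold_unit_in_unit_interval [of j y] by (simp only: \<phi>0_def if_False)
  have main: "?A \<and> ?B" if x: "x \<in> {0<..<1}"
  proof -
    define y where "y = real n * x"
    have y: "0 < y" "y < real n" using x n by (simp_all add: y_def)
    define i where "i = nat \<lfloor>y\<rfloor>"
    have i: "real i \<le> y" "y < real i + 1"
      using y by (simp_all add: i_def)
    have "i < n" using i y by linarith
    have others: "\<phi>0 (fold_unit j y) = 0" if "j \<noteq> i" for j
    proof (rule zero)
      show "\<not> (real j < y \<and> y < real j + 1)"
        using that i by linarith
    qed
    have ext: "dilation_system \<phi> n x = (-1) ^ i * \<phi>0 (fold_unit i y)"
      unfolding dilation_system_def y_def [symmetric] \<phi>0_def by (rule odd_periodic_ext_piece [OF i])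
    have "(\<Sum>j<n. (-1) ^ j * \<phi>0 (fold_unit j y)) = (\<Sum>j\<in>{i}. (-1) ^ j * \<phi>0 (fold_unit j y))"
      by (rule sum.mono_neutral_right) (use \<open>i < n\<close> others in auto)
    moreover have "(\<Sum>j<n. (cmod (\<phi>0 (fold_unit j y)))\<^sup>2) = (\<Sum>j\<in>{i}. (cmod (\<phi>0 (fold_unit j y)))\<^sup>2)"
      by (rule sum.mono_neutral_right) (use \<open>i < n\<close> others in auto)
    ultimately show ?thesis
      using x ext by (simp add: y_def [symmetric] norm_mult norm_power)
  qed
  show ?A if "x \<in> {0<..<1}" using main [OF that] by blast
  show ?B
  proof (cases "x \<in> {0<..<1}")
    case False
    have "\<phi>0 (fold_unit j (real n * x)) = 0" if "j < n" for j
    proof (rule zero, rule notI)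
      assume *: "real j < real n * x \<and> real n * x < real j + 1"
      then have "0 < real n * x" "real n * x < real n * 1" using that by linarith+
      then show False using False n by (simp add: zero_less_mult_iff)
    qed
    then show ?thesis unfolding if_not_P [OF False] by simp
  qed (use main in blast)
qed

text \<open>Each of the \<open>n\<close> pieces is an affine copy of \<open>\<phi>\<close> with
  slope of modulus \<open>n\<close>. It carries the fraction \<open>1 / n\<close> of the squared
  norm, so the total is preserved.\<close>

lemma
  assumes \<phi>: "\<phi> \<in> L2_01" and n: "n > 0"
  shows dilation_system_L2_01: "dilation_system \<phi> n \<in> L2_01"
    and L2_sq_dilation_system: "L2_sq (dilation_system \<phi> n) = L2_sq \<phi>"
proof -
  define \<phi>0 where "\<phi>0 = (\<lambda>x. if x \<in> {0<..<1} then \<phi> x else 0)"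
  define t c where "t j = (if even j then - real j else real j + 1)"
    and "c j = (if even j then real n else - real n)" for j :: nat
  have fold_eq: "fold_unit j (real n * x) = t j + c j * x" for j x
    by (simp add: fold_unit_def t_def c_def)
  have c: "c j \<noteq> 0" "\<bar>c j\<bar> = real n" for j
    using n by (simp_all add: c_def)
  have \<phi>0_meas: "\<phi>0 \<in> borel_measurable lebesgue"
    unfolding \<phi>0_def using L2_01_measurable [OF \<phi>] by (intro borel_measurable_if_I) auto
  have sq_eq: "(cmod (\<phi>0 x))\<^sup>2 = (if x \<in> {0<..<1} then (cmod (\<phi> x))\<^sup>2 else 0)" for x
    by (simp add: \<phi>0_def)
  have \<phi>0_int: "integrable lebesgue (\<lambda>x. (cmod (\<phi>0 x))\<^sup>2)"
    unfolding sq_eq using L2_01_integrable [OF \<phi>] by (subst Lebesgue_Measure.integrable_restrict_UNIV) auto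
  have \<phi>0_sq: "(\<integral>x. (cmod (\<phi>0 x))\<^sup>2 \<partial>lebesgue) = L2_sq \<phi>"
    unfolding sq_eq L2_sq_def by (rule Lebesgue_Measure.integral_restrict_UNIV) simp
  have piece_int: "integrable lebesgue (\<lambda>x. (cmod (\<phi>0 (t j + c j * x)))\<^sup>2)" for j
    using lebesgue_integrable_real_affine [OF \<phi>0_int c(1)] .
  have piece: "(\<integral>x. (cmod (\<phi>0 (t j + c j * x)))\<^sup>2 \<partial>lebesgue) = L2_sq \<phi> / n" for j
    using lebesgue_integral_real_affine [OF c(1), of "\<lambda>x. (cmod (\<phi>0 x))\<^sup>2" j "t j"] n
    unfolding \<phi>0_sq c(2) by (simp add: field_simps)
  have sq: "(if x \<in> {0<..<1} then (cmod (dilation_system \<phi> n x))\<^sup>2 else 0) =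
      (\<Sum>j<n. (cmod (\<phi>0 (t j + c j * x)))\<^sup>2)" for x
    using cmod_dilation_system_pieces [OF n, of x \<phi>] unfolding \<phi>0_def fold_eq .
  have "(\<lambda>x. \<phi>0 (t j + c j * x)) \<in> borel_measurable lebesgue" for j
    using borel_measurable_affine [OF \<phi>0_meas c(1), of "t j" j] by simp
  then have "(\<lambda>x. \<Sum>j<n. (-1) ^ j * \<phi>0 (t j + c j * x)) \<in> borel_measurable lebesgue"
    by (intro borel_measurable_sum borel_measurable_times) auto
  then have "(\<lambda>x. \<Sum>j<n. (-1) ^ j * \<phi>0 (t j + c j * x)) \<in> borel_measurable unit_interval"
    by (rule measurable_restrict_space1)
  moreover have "dilation_system \<phi> n x = (\<Sum>j<n. (-1) ^ j * \<phi>0 (t j + c j * x))" if "x \<in> {0<..<1}" for x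
    using dilation_system_pieces [OF n that, of \<phi>] unfolding \<phi>0_def fold_eq .
  ultimately have meas: "dilation_system \<phi> n \<in> borel_measurable unit_interval"
    by (subst measurable_cong [of unit_interval _ "\<lambda>x. \<Sum>j<n. (-1) ^ j * \<phi>0 (t j + c j * x)"]) auto
  have "integrable lebesgue (\<lambda>x. \<Sum>j<n. (cmod (\<phi>0 (t j + c j * x)))\<^sup>2)"
    by (intro Bochner_Integration.integrable_sum piece_int)
  then have "integrable unit_interval (\<lambda>x. (cmod (dilation_system \<phi> n x))\<^sup>2)"
    unfolding sq [symmetric] by (subst (asm) Lebesgue_Measure.integrable_restrict_UNIV) auto
  then show "dilation_system \<phi> n \<in> L2_01" using meas by (simp add: L2_01_def)
  have "L2_sq (dilation_system \<phi> n) =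
      (\<integral>x. (if x \<in> {0<..<1} then (cmod (dilation_system \<phi> n x))\<^sup>2 else 0) \<partial>lebesgue)"
    unfolding L2_sq_def by (rule Lebesgue_Measure.integral_restrict_UNIV [symmetric]) simp
  also have "\<dots> = (\<Sum>j<n. \<integral>x. (cmod (\<phi>0 (t j + c j * x)))\<^sup>2 \<partial>lebesgue)"
    unfolding sq by (intro Bochner_Integration.integral_sum piece_int)
  also have "\<dots> = L2_sq \<phi>" using n by (simp add: piece)
  finally show "L2_sq (dilation_system \<phi> n) = L2_sq \<phi>" .
qed

text \<open>For a sine partial sum of \<open>\<phi>\<close> the pairing is the corresponding finite
  sum. The error is controlled by Cauchy-Schwarz, since dilation preserves the distance from
  \<open>\<phi>\<close> to its partial sum.\<close>

lemma L2_inner_dilation_system_sums: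
  assumes f: "f \<in> L2_01" and \<phi>: "\<phi> \<in> L2_01" and n: "n > 0"
  shows "(\<lambda>k. S_transform f (n * k) * cnj (S_transform \<phi> k)) sums L2_inner f (dilation_system \<phi> n)"
  unfolding sums_def_le
proof -
  let ?p = "sine_sum (S_transform \<phi>)" and ?g = "dilation_system \<phi> n"
  let ?s = "\<lambda>N. \<Sum>k\<le>N. S_transform f (n * k) * cnj (S_transform \<phi> k)"
  have inner: "L2_inner f (dilation_system (?p N) n) = ?s N" for N
  proof -
    have "L2_inner (dilation_system (?p N) n) f =
        (\<Sum>k=1..N. L2_inner (\<lambda>x. S_transform \<phi> k * sine_basis (n * k) x) f)"
      unfolding dilation_system_sine_sum [abs_def]
      by (intro L2_inner_sum_left L2_01_scale sine_basis_L2_01 f)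
    also have "\<dots> = (\<Sum>k=1..N. S_transform \<phi> k * cnj (S_transform f (n * k)))"
      by (rule sum.cong) (use n in \<open>auto simp: L2_inner_scale_left S_transform_def L2_inner_commute\<close>)
    also have "\<dots> = (\<Sum>k\<le>N. S_transform \<phi> k * cnj (S_transform f (n * k)))"
      by (rule sum.mono_neutral_left) (auto simp: S_transform_def not_less_eq_eq)
    finally show ?thesis
      by (subst L2_inner_commute [symmetric]) (simp add: mult.commute)
  qed
  have bound: "norm (L2_inner f ?g - ?s N) \<le> sqrt (L2_sq f * L2_sq (\<lambda>x. \<phi> x - ?p N x))" for N
  proof -
    note L2 = dilation_system_L2_01 [OF \<phi> n] dilation_system_L2_01 [OF sine_sum_L2_01 n]
    have "L2_inner f ?g - ?s N = L2_inner f (\<lambda>x. ?g x - dilation_system (?p N) n x)"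
      by (simp add: L2_inner_diff_right L2 f inner)
    also have "(\<lambda>x. ?g x - dilation_system (?p N) n x) = dilation_system (\<lambda>x. \<phi> x - ?p N x) n"
      by (simp add: dilation_system_diff fun_eq_iff)
    finally have "(norm (L2_inner f ?g - ?s N))\<^sup>2 \<le>
        L2_sq f * L2_sq (dilation_system (\<lambda>x. \<phi> x - ?p N x) n)"
      using L2_Cauchy_Schwarz f dilation_system_L2_01 [OF L2_01_diff [OF \<phi> sine_sum_L2_01] n] by simp
    also have "L2_sq (dilation_system (\<lambda>x. \<phi> x - ?p N x) n) = L2_sq (\<lambda>x. \<phi> x - ?p N x)"
      by (rule L2_sq_dilation_system [OF L2_01_diff [OF \<phi> sine_sum_L2_01] n])
    finally show ?thesis by (rule real_le_rsqrt)
  qed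
  have "(\<lambda>N. sqrt (L2_sq f * L2_sq (\<lambda>x. \<phi> x - ?p N x))) \<longlonglongrightarrow> sqrt (L2_sq f * 0)"
    by (intro tendsto_intros L2_sq_diff_partial_sums_tendsto \<phi>)
  then have "(\<lambda>N. L2_inner f ?g - ?s N) \<longlonglongrightarrow> 0"
    by (intro Lim_null_comparison [OF always_eventually [OF allI [OF bound]]]) simp
  from tendsto_diff [OF tendsto_const [of "L2_inner f ?g"] this]
  show "?s \<longlonglongrightarrow> L2_inner f ?g" by simp
qed

section \<open>Frame inequalities as inequalities for the adjoint\<close>

lemma S_transform_hardy_dirichlet:
  assumes "f \<in> L2_01"
  shows "S_transform f \<in> hardy_dirichlet" "sqsum N (S_transform f) \<le> L2_sq f"
  using Bessel_inequality [OF assms]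
  by (auto simp: hardy_dirichlet_iff_sqsum sqsum_def S_transform_def)

lemma L2_inner_dilation_system:
  assumes "f \<in> L2_01" "\<phi> \<in> L2_01" "n > 0"
  shows "L2_inner f (dilation_system \<phi> n) = dirichlet_adjoint (S_transform \<phi>) (S_transform f) n"
  unfolding dirichlet_adjoint_def
  by (rule sums_unique [OF L2_inner_dilation_system_sums [OF assms]])

lemma sum_sq_coeffs_dilation_system_le_iff:
  assumes f: "f \<in> L2_01" and \<phi>: "\<phi> \<in> L2_01" and c: "c \<ge> 0"
  shows "sum_sq_coeffs f (dilation_system \<phi>) \<le> ennreal c \<longleftrightarrow>
    (\<forall>N. sqsum N (dirichlet_adjoint (S_transform \<phi>) (S_transform f)) \<le> c)"
proof -
  let ?g = "dirichlet_adjoint (S_transform \<phi>) (S_transform f)"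
  have s: "sum_sq_coeffs f (dilation_system \<phi>) = (\<Sum>n. ennreal ((cmod (?g (Suc n)))\<^sup>2))"
    unfolding sum_sq_coeffs_def by (simp add: L2_inner_dilation_system [OF f \<phi>])
  have part: "(\<Sum>n<N. ennreal ((cmod (?g (Suc n)))\<^sup>2)) = ennreal (sqsum N ?g)" for N
    unfolding sqsum_def One_nat_def sum.atLeast1_atMost_eq by (rule sum_ennreal) simp
  show ?thesis
  proof
    assume "sum_sq_coeffs f (dilation_system \<phi>) \<le> ennreal c"
    then have "ennreal (sqsum N ?g) \<le> ennreal c" for N
      unfolding s part [symmetric] by (rule order_trans [OF sum_le_suminf, rotated 3]) auto
    then show "\<forall>N. sqsum N ?g \<le> c" using c by simp
  next
    assume "\<forall>N. sqsum N ?g \<le> c"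
    then show "sum_sq_coeffs f (dilation_system \<phi>) \<le> ennreal c"
      unfolding s by (intro suminf_le_const) (auto simp: part ennreal_leI)
  qed
qed

lemma S_transform_sine_sum_eq_trunc: "S_transform (sine_sum c N) = trunc N c"
  by (simp add: fun_eq_iff S_transform_sine_sum trunc_def)

lemma L2_sq_sine_sum: "L2_sq (sine_sum c N) = sqsum N c"
  using L2_sq_diff_sine_sum [OF sine_sum_L2_01, of c N c N]
  by (simp add: S_transform_sine_sum L2_sq_def sqsum_def)

text \<open>Sine sums have exactly the truncations as transforms, so testing on them bounds the
  adjoint on finite sequences. The converse applies the adjoint bound to the transform of an
  arbitrary \<open>f\<close>.\<close>

lemma bessel_sequence_dilation_system_iff:
  assumes \<phi>: "\<phi> \<in> L2_01"
  shows "bessel_sequence (dilation_system \<phi>) \<longleftrightarrow> S_transform \<phi> \<in> multipliers"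
proof
  assume "bessel_sequence (dilation_system \<phi>)"
  then obtain B where B: "B > 0"
    and le: "\<And>f. f \<in> L2_01 \<Longrightarrow> sum_sq_coeffs f (dilation_system \<phi>) \<le> ennreal (B * L2_sq f)"
    by (auto simp: bessel_sequence_def L2_norm_square)
  have "sqsum N (dirichlet_adjoint (S_transform \<phi>) (trunc N c)) \<le> B * sqsum N c" for c N
    using le [OF sine_sum_L2_01, of c N] B
    by (simp add: sum_sq_coeffs_dilation_system_le_iff [OF sine_sum_L2_01 \<phi>] L2_sq_sine_sum
        S_transform_sine_sum_eq_trunc)
  then have "mult_bounded B (S_transform \<phi>)"
    using B by (intro mult_bounded_of_adjoint) auto
  then show "S_transform \<phi> \<in> multipliers"
    using B by (intro multiplier_of_mult_bounded) (auto simp: dirichlet_series_def S_transform_def)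
next
  assume "S_transform \<phi> \<in> multipliers"
  then obtain B where B: "B \<ge> 0" "mult_bounded B (S_transform \<phi>)"
    by (rule mult_bounded_of_multiplier)
  \<comment> \<open>A Bessel bound has to be positive, while \<open>B\<close> may be 0.\<close>
  have "sum_sq_coeffs f (dilation_system \<phi>) \<le> ennreal ((B + 1) * (L2_norm f)\<^sup>2)" if f: "f \<in> L2_01" for f
  proof -
    have "sqsum N (dirichlet_adjoint (S_transform \<phi>) (S_transform f)) \<le> L2_sq f * B" for N
      using S_transform_hardy_dirichlet f \<phi>
      by (intro sqsum_dirichlet_adjoint_le B adjoint_summable_hardy) auto
    moreover have "L2_sq f * B \<le> (B + 1) * L2_sq f"
      using L2_sq_nonneg [of f] by (simp add: algebra_simps)
    ultimately show ?thesis
      unfolding L2_norm_square using B L2_sq_nonneg [of f]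
      by (subst sum_sq_coeffs_dilation_system_le_iff [OF f \<phi>]) (auto intro: order_trans)
  qed
  then show "bessel_sequence (dilation_system \<phi>)"
    unfolding bessel_sequence_def using B by (intro exI [of _ "B + 1"]) auto
qed

lemma lower_frame_bound_dilation_system_iff:
  assumes \<phi>: "\<phi> \<in> L2_01"
  shows "lower_frame_bound (dilation_system \<phi>) \<longleftrightarrow> reciprocal_is_multiplier (S_transform \<phi>)"
proof
  let ?a = "S_transform \<phi>"
  assume "lower_frame_bound (dilation_system \<phi>)"
  then obtain A where A: "A > 0"
    and le: "\<And>f. f \<in> L2_01 \<Longrightarrow> ennreal (A * L2_sq f) \<le> sum_sq_coeffs f (dilation_system \<phi>)"
    by (auto simp: lower_frame_bound_def L2_norm_square)
  have adj: "A * sqsum N c \<le> sqsum N (dirichlet_adjoint ?a (trunc N c))" for c N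
  proof -
    let ?g = "dirichlet_adjoint ?a (trunc N c)"
    \<comment> \<open>The adjoint of a sequence supported on \<open>1..N\<close> vanishes beyond
      \<open>N\<close>, so the whole series is already its \<open>N\<close>-th partial sum.\<close>
    have "sqsum M ?g \<le> sqsum N ?g" for M
      using sqsum_mono [of M "max M N" ?g] sqsum_eq_of_support [of N ?g "max M N"]
      by (simp add: dirichlet_adjoint_trunc_eq_0)
    then have "sum_sq_coeffs (sine_sum c N) (dilation_system \<phi>) \<le> ennreal (sqsum N ?g)"
      by (simp add: sum_sq_coeffs_dilation_system_le_iff [OF sine_sum_L2_01 \<phi>]
          S_transform_sine_sum_eq_trunc)
    with le [OF sine_sum_L2_01, of c N] have "ennreal (A * sqsum N c) \<le> ennreal (sqsum N ?g)"
      unfolding L2_sq_sine_sum by (rule order_trans)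
    then show ?thesis by simp
  qed
  \<comment> \<open>Tested on the first basis vector, the lower bound sees only the conjugate of
    \<open>?a 1\<close>.\<close>
  have "?a 1 \<noteq> 0"
  proof
    assume "?a 1 = 0"
    then have "trunc 1 dirichlet_one (1 * k) * cnj (?a k) = 0" for k
      by (auto simp: trunc_def)
    then have "dirichlet_adjoint ?a (trunc 1 dirichlet_one) 1 = 0"
      by (simp only: dirichlet_adjoint_def suminf_zero)
    then show False
      using adj [of 1 dirichlet_one] A by (simp add: sqsum_def dirichlet_one_def)
  qed
  then have inv: "is_dirichlet_inverse ?a (dirichlet_inv ?a)"
    by (rule is_dirichlet_inverse_dirichlet_inv)
  then have "mult_bounded (1 / A) (dirichlet_inv ?a)"
    using A adj by (intro mult_bounded_inverse_of_adjoint) (auto simp: is_dirichlet_inverse_def)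
  then have "dirichlet_inv ?a \<in> multipliers"
    using inv A by (intro multiplier_of_mult_bounded) (auto simp: is_dirichlet_inverse_def)
  then show "reciprocal_is_multiplier ?a"
    using inv by (auto simp: reciprocal_is_multiplier_def)
next
  let ?a = "S_transform \<phi>"
  assume "reciprocal_is_multiplier ?a"
  then obtain b where inv: "?a \<star> b = dirichlet_one" and "b \<in> multipliers"
    by (auto simp: reciprocal_is_multiplier_def is_dirichlet_inverse_def)
  then obtain B where B: "B \<ge> 0" "mult_bounded B b"
    using mult_bounded_of_multiplier by blast
  have "ennreal (1 / (B + 1) * (L2_norm f)\<^sup>2) \<le> sum_sq_coeffs f (dilation_system \<phi>)"
    if f: "f \<in> L2_01" for f
  proof (cases "sum_sq_coeffs f (dilation_system \<phi>)")
    \<comment> \<open>Only a finite sum needs an argument. The value \<open>R\<close> itself then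
      bounds the adjoint, and Parseval turns the resulting bound on coefficients into one on
      \<open>f\<close>.\<close>
    case (real R)
    then have "sqsum N (dirichlet_adjoint ?a (S_transform f)) \<le> R" for N
      using sum_sq_coeffs_dilation_system_le_iff [OF f \<phi>, of R] by simp
    then have "sqsum M (S_transform f) \<le> R * B" for M
      using S_transform_hardy_dirichlet f \<phi> by (intro sqsum_le_adjoint_of_inverse [OF _ _ inv] B) auto
    then have "L2_sq f \<le> R * B"
      using LIMSEQ_le_const2 [OF Parseval [OF f]] by (auto simp: sqsum_def)
    also have "\<dots> \<le> R * (B + 1)" using real by (simp add: algebra_simps)
    finally have "1 / (B + 1) * L2_sq f \<le> R" using B by (simp add: field_simps)
    then show ?thesis unfolding L2_norm_square real by (rule ennreal_leI)
  qed simp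
  then show "lower_frame_bound (dilation_system \<phi>)"
    unfolding lower_frame_bound_def using B by (intro exI [of _ "1 / (B + 1)"]) auto
qed

theorem theorem3p4:
  fixes \<phi> :: "real \<Rightarrow> complex"
  assumes "\<phi> \<in> L2_01"
  shows "(bessel_sequence (dilation_system \<phi>) \<longleftrightarrow> S_transform \<phi> \<in> multipliers) \<and>
         (lower_frame_bound (dilation_system \<phi>) \<longleftrightarrow> reciprocal_is_multiplier (S_transform \<phi>))"
  using assms
  by (simp add: bessel_sequence_dilation_system_iff lower_frame_bound_dilation_system_iff)

end
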